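(* Let $F(z)$ be the unique formal power series solution to the functional equation $$zF^6(z)-F(z)+1=0.$$ Then the coefficient of $z^n$ in $F(z)$ is odd if, and only if, the sequence of binary digits of $n$ (where leading zeros may be added) is built by concatenating (in any order) blocks of $0011$ and $01$. In particular, for $n\ge1$, the number of free subgroups of index $14n$ in $\mathfrak H(7)=C_2*C_7$ is odd if, and only if, the sequence of binary digits of $n$ (where leading zeros may be added) is built by concatenating (in any order) blocks of $0011$ and $01$.
   Context: $\mathfrak H(7)=C_2*C_7$ is the free product of cyclic groups of orders $2$ and $7$. $F^6(z)$ denotes $(F(z))^6$. (Known fact used for the last assertion: the coefficient of $z^\lambda$ in $F(z)$ has the same parity as the number of free subgroups of index $14\lambda$ in $\mathfrak H(7)$.) *)

theory Defs
  imports
    "HOL-Computational_Algebra.Formal_Power_Series"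
    "HOL-Algebra.Elementary_Groups"
begin

subsection \<open>Monoid presentations\<close>

definition word_step :: "('a list \<times> 'a list) set \<Rightarrow> 'a list \<Rightarrow> 'a list \<Rightarrow> bool" where
  "word_step R u v \<longleftrightarrow> (\<exists>x y l r. (l, r) \<in> R \<and> u = x @ l @ y \<and> v = x @ r @ y)"

definition word_class :: "'a set \<Rightarrow> ('a list \<times> 'a list) set \<Rightarrow> 'a list \<Rightarrow> 'a list set" where
  "word_class A R u = {v \<in> lists A. equivclp (word_step R) u v}"

text \<open>
  The monoid with generators \<open>A\<close> and defining relations \<open>l = r\<close> for \<open>(l, r) \<in> R\<close>, where
  \<open>R \<subseteq> lists A \<times> lists A\<close> is intended: classes of words over \<open>A\<close> modulo the congruence generated
  by \<open>R\<close>. The union in the product of two classes consists of a single class.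
\<close>

definition presented_monoid :: "'a set \<Rightarrow> ('a list \<times> 'a list) set \<Rightarrow> 'a list set monoid" where
  "presented_monoid A R =
     \<lparr>carrier = word_class A R ` lists A,
      monoid.mult = (\<lambda>P Q. \<Union>p\<in>P. \<Union>q\<in>Q. word_class A R (p @ q)),
      one = word_class A R []\<rparr>"

subsection \<open>Free products and free groups\<close>

definition free_product_rels ::
  "('a, 'c) monoid_scheme \<Rightarrow> ('b, 'd) monoid_scheme \<Rightarrow> (('a + 'b) list \<times> ('a + 'b) list) set" where
  "free_product_rels G H =
     {([Inl \<one>\<^bsub>G\<^esub>], []), ([Inr \<one>\<^bsub>H\<^esub>], [])} \<union>
     {([Inl a, Inl b], [Inl (a \<otimes>\<^bsub>G\<^esub> b)]) | a b. a \<in> carrier G \<and> b \<in> carrier G} \<union>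
     {([Inr a, Inr b], [Inr (a \<otimes>\<^bsub>H\<^esub> b)]) | a b. a \<in> carrier H \<and> b \<in> carrier H}"

definition free_product ::
  "('a, 'c) monoid_scheme \<Rightarrow> ('b, 'd) monoid_scheme \<Rightarrow> ('a + 'b) list set monoid" where
  "free_product G H = presented_monoid (carrier G <+> carrier H) (free_product_rels G H)"

text \<open>
  In the free group on \<open>X\<close>, the letter \<open>(x, True)\<close> stands for \<open>x\<close> and \<open>(x, False)\<close> for its
  formal inverse.
\<close>

definition free_group :: "'a set \<Rightarrow> ('a \<times> bool) list set monoid" where
  "free_group X =
     presented_monoid (X \<times> UNIV) {([(x, e), (x, \<not> e)], []) | x e. x \<in> X}"

text \<open>
  Restricting \<open>X\<close> to the type of the elements of \<open>G\<close> loses nothing, since a basis of \<open>G\<close> is a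
  subset of \<open>carrier G\<close>. The trivial group is free, with \<open>X = {}\<close>.
\<close>

definition is_free_group :: "('a, 'c) monoid_scheme \<Rightarrow> bool" where
  "is_free_group G \<longleftrightarrow> group G \<and> (\<exists>X :: 'a set. G \<cong> free_group X)"

text \<open>
  An infinite set of cosets has cardinality \<open>0\<close>, so only for \<open>k > 0\<close> is this the set of free
  subgroups of index \<open>k\<close>.
\<close>

definition free_subgroups_of_index :: "('a, 'c) monoid_scheme \<Rightarrow> nat \<Rightarrow> 'a set set" where
  "free_subgroups_of_index G k =
     {S. subgroup S G \<and> is_free_group (G\<lparr>carrier := S\<rparr>) \<and> card (rcosets\<^bsub>G\<^esub> S) = k}"

definition hecke_group_7 :: "(int + int) list set monoid" where
  "hecke_group_7 = free_product (integer_mod_group 2) (integer_mod_group 7)"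

subsection \<open>Binary digits\<close>

text \<open>
  Digit sequences are written with the most significant digit first and may carry any number of
  leading zeros; the empty sequence represents \<open>0\<close>.
\<close>

definition is_binary_expansion :: "nat list \<Rightarrow> nat \<Rightarrow> bool" where
  "is_binary_expansion ds n \<longleftrightarrow> set ds \<subseteq> {0, 1} \<and> horner_sum id 2 (rev ds) = n"

definition built_from_blocks :: "nat \<Rightarrow> bool" where
  "built_from_blocks n \<longleftrightarrow>
     (\<exists>bs. set bs \<subseteq> {[0, 0, 1, 1], [0, 1]} \<and> is_binary_expansion (concat bs) n)"

end

theory Submission
  imports Defs "HOL-Combinatorics.Permutations"
begin

text \<open>
  Modulo 2, squaring \<open>F = 1 + z F^6\<close> gives \<open>F^2 = 1 + z^2 F^12\<close>, hence
  \<open>F = 1 + z F^4 + z^3 F^16\<close>. As \<open>F^4 = F(z^4)\<close> and \<open>F^16 = F(z^16)\<close> modulo 2, the coefficient of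
  \<open>z^n\<close> is odd iff \<open>n = 0\<close>, or \<open>n = 4 m + 1\<close> or \<open>n = 16 m + 3\<close> with an odd coefficient at \<open>m\<close>,
  that is, iff a final block \<open>01\<close> or \<open>0011\<close> can be stripped off.

  A subgroup of finite index is free iff both generators act on its cosets without fixed points
  (as regular permutations of orders 2 and 7): free groups are torsion-free, and conversely the
  stabiliser of a point is the fundamental group of a graph. So \<open>(N - 1)!\<close> times the number of free
  subgroups of index \<open>N\<close> counts the transitive pairs of such permutations of \<open>N\<close> points. All pairs
  are counted explicitly, and splitting off the orbit of one point relates the two counts. With
  \<open>D\<close> the series of the numbers of all pairs divided by \<open>(14 n)!\<close>, the subgroup series is
  \<open>S = 14 z D'/D\<close>, and the hypergeometric recurrence for \<open>D\<close> becomes a differential equation for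
  \<open>S\<close> with integer coefficients that reduces to \<open>S = z (1 + S)^6\<close> modulo 2.
\<close>

text \<open>Both generators have finite order, so positive words in two letters represent every
  group element, and words can be plain \<open>bool list\<close>s. They act from the right, first
  letter first, to match right cosets. Distinctness of elements of C2*C7 is always shown by letting
  the group act on a suitable set. The pair count is set up for arbitrary orders p and q because q =
  1 turns the orbit-splitting recurrence into one for single permutations of order p; this is how
  the explicit counts are found. The coefficients of D are rational (the first is 19305/14), so
  parity makes sense only after D has been eliminated. Of the fourteen factors of (14n+14)!/(14n)!,
  the even ones and 14n+7 cancel against the closed counts; six factors 14n+c with c odd and prime
  to 7 remain. Conjugated by D, each becomes w -> 14 z w' + (c + S) w, which modulo 2 is
  multiplication by 1 + S. This is the origin of the exponent 6.\<close>

unbundle fps_syntax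

subsection \<open>The functional equation modulo 2\<close>

text \<open>Since \<open>fps_X\<close> shifts by one, this makes coefficient n of
  \<open>1 + fps_X * F ^ k\<close> depend only on coefficients of \<open>F\<close> below n.
  Uniqueness and existence both rest on it.\<close>

lemma fps_power_nth_cong:
  fixes F G :: "'a::comm_ring_1 fps"
  assumes "\<And>i. i \<le> n \<Longrightarrow> F $ i = G $ i"
  shows "(F ^ k) $ n = (G ^ k) $ n"
  using assms
proof (induction k arbitrary: n)
  case (Suc k)
  have "(F * F ^ k) $ n = (G * G ^ k) $ n"
    unfolding fps_mult_nth by (rule sum.cong) (use Suc in auto)
  then show ?case by simp
qed simp

lemma fps_functional_equation_unique:
  fixes F G :: "'a::comm_ring_1 fps"
  assumes "F = 1 + fps_X * F ^ k" "G = 1 + fps_X * G ^ k"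
  shows "F = G"
proof (rule fps_ext)
  fix n
  show "F $ n = G $ n"
  proof (induction n rule: less_induct)
    case (less n)
    show ?case
    proof (cases n)
      case 0
      then show ?thesis by (subst assms(1), subst assms(2)) simp
    next
      case (Suc m)
      have "(F ^ k) $ m = (G ^ k) $ m"
        by (rule fps_power_nth_cong) (use less Suc in auto)
      then show ?thesis using Suc by (subst assms(1), subst assms(2)) simp
    qed
  qed
qed

text \<open>Iterating the right-hand side from 1, coefficient n is final after n rounds, so the
  diagonal of the iterates solves the equation.\<close>

lemma fps_functional_equation_exists: "\<exists>F :: 'a::comm_ring_1 fps. F = 1 + fps_X * F ^ k"
proof -
  define step where "step F = 1 + fps_X * F ^ k" for F :: "'a fps"
  define It where "It m = (step ^^ m) 1" for m
  have It_Suc: "It (Suc m) = 1 + fps_X * It m ^ k" for m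
    by (simp add: It_def step_def)
  have stable: "It (Suc m) $ n = It m $ n" if "n \<le> m" for m n
    using that
  proof (induction m arbitrary: n)
    case 0
    then show ?case by (simp add: It_Suc) (simp add: It_def)
  next
    case (Suc m)
    show ?case
    proof (cases n)
      case (Suc i)
      have "(It (Suc m) ^ k) $ i = (It m ^ k) $ i"
        by (rule fps_power_nth_cong) (use Suc Suc.IH Suc.prems in auto)
      then show ?thesis using Suc by (simp add: It_Suc[of "Suc m"] It_Suc[of m])
    qed (simp add: It_Suc)
  qed
  have stable': "It m $ n = It n $ n" if "n \<le> m" for m n
    using that by (induction m rule: dec_induct) (simp_all add: stable)
  define F where "F = Abs_fps (\<lambda>n. It n $ n)"
  have "F = 1 + fps_X * F ^ k"
  proof (rule fps_ext)
    fix n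
    show "F $ n = (1 + fps_X * F ^ k) $ n"
    proof (cases n)
      case 0
      then show ?thesis by (simp add: F_def It_def)
    next
      case (Suc m)
      have "(It m ^ k) $ m = (F ^ k) $ m"
        by (rule fps_power_nth_cong) (auto simp: F_def intro: stable')
      then show ?thesis using Suc by (simp add: F_def It_Suc)
    qed
  qed
  then show ?thesis by blast
qed

lemma two_dvd_fps_iff: "2 dvd (F :: int fps) \<longleftrightarrow> (\<forall>n. even (F $ n))"
proof -
  have double: "(2 * G) $ n = 2 * (G $ n)" for G :: "int fps" and n
    by (simp only: mult_2 fps_add_nth)
  show ?thesis
  proof
    assume "2 dvd F"
    then obtain D where D: "F = 2 * D" by (rule dvdE)
    show "\<forall>n. even (F $ n)" unfolding D double by simp
  next
    assume *: "\<forall>n. even (F $ n)"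
    have "F = 2 * Abs_fps (\<lambda>n. F $ n div 2)"
      by (rule fps_ext) (use * in \<open>simp only: double fps_nth_Abs_fps dvd_mult_div_cancel\<close>)
    then show "2 dvd F" by (rule dvdI)
  qed
qed

text \<open>The Frobenius map modulo 2. With F = c + zG the cross term of the square is even, and
  z^2 G^2 moves the question from n to n - 2 with \<open>G\<close> in place of \<open>F\<close>;
  hence the induction over all series.\<close>

lemma odd_fps_square_nth:
  fixes F :: "int fps"
  shows "odd ((F ^ 2) $ n) \<longleftrightarrow> even n \<and> odd (F $ (n div 2))"
proof (induction n arbitrary: F rule: less_induct)
  case (less n)
  define c where "c = F $ 0"
  define G where "G = Abs_fps (\<lambda>n. F $ Suc n)"
  have F: "F = fps_const c + fps_X * G"
  proof (rule fps_ext)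
    fix n show "F $ n = (fps_const c + fps_X * G) $ n"
      by (cases n) (simp_all add: c_def G_def)
  qed
  have sq: "F ^ 2 = fps_const (c ^ 2) + fps_X * (fps_X * G ^ 2) + 2 * (fps_const c * (fps_X * G))"
    unfolding F power2_sum by (simp add: power_mult_distrib power2_eq_square algebra_simps)
  have "even ((2 * (fps_const c * (fps_X * G))) $ n)"
    using two_dvd_fps_iff by (metis dvd_triv_left)
  then have 1: "odd ((F ^ 2) $ n) \<longleftrightarrow> odd ((fps_const (c ^ 2) + fps_X * (fps_X * G ^ 2)) $ n)"
    unfolding sq by simp
  show ?case
  proof (cases "n < 2")
    case True
    then have "n = 0 \<or> n = 1" by auto
    then show ?thesis unfolding 1 by (auto simp: c_def)
  next
    case False
    then obtain m where m: "n = Suc (Suc m)" by (metis less_2_cases_iff not0_implies_Suc One_nat_def)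
    show ?thesis unfolding 1 using less[of m G] by (simp add: m G_def)
  qed
qed

lemma odd_fps_power4_nth:
  "odd (((F :: int fps) ^ 4) $ n) \<longleftrightarrow> 4 dvd n \<and> odd (F $ (n div 4))"
proof -
  have "F ^ 4 = (F ^ 2) ^ 2" by simp
  then have "odd ((F ^ 4) $ n) \<longleftrightarrow> even n \<and> even (n div 2) \<and> odd (F $ (n div 2 div 2))"
    by (simp only: odd_fps_square_nth)
  moreover have "4 dvd n \<longleftrightarrow> even n \<and> even (n div 2)" by presburger
  ultimately show ?thesis by (simp add: div_mult2_eq[symmetric])
qed

lemma odd_fps_power16_nth:
  "odd (((F :: int fps) ^ 16) $ n) \<longleftrightarrow> 16 dvd n \<and> odd (F $ (n div 16))"
proof -
  have "F ^ 16 = (F ^ 4) ^ 4" by simp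
  then have "odd ((F ^ 16) $ n) \<longleftrightarrow> 4 dvd n \<and> 4 dvd (n div 4) \<and> odd (F $ (n div 4 div 4))"
    by (simp only: odd_fps_power4_nth)
  moreover have "16 dvd n \<longleftrightarrow> 4 dvd n \<and> 4 dvd (n div 4)" by presburger
  ultimately show ?thesis by (simp add: div_mult2_eq[symmetric])
qed

text \<open>The new exponents 4 and 16 are powers of 2, so the Frobenius map evaluates them, unlike
  6. A congruence is assumed because the subgroup series satisfies the equation only modulo
  2.\<close>

lemma functional_equation_mod2:
  fixes F :: "int fps"
  assumes "2 dvd F - (1 + fps_X * F ^ 6)"
  shows "2 dvd F - (1 + fps_X * F ^ 4 + fps_X ^ 3 * F ^ 16)"
proof -
  obtain D where D: "F - (1 + fps_X * F ^ 6) = 2 * D" using assms by auto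
  define Y where "Y = fps_X * F ^ 6"
  have F: "F = 1 + Y + 2 * D" using D by (simp add: Y_def algebra_simps)
  have "F ^ 2 = 1 + Y ^ 2 + 2 * (Y + 2 * D * (1 + Y) + 2 * D ^ 2)"
    by (subst F) (simp add: power2_eq_square algebra_simps)
  then have "2 dvd F ^ 2 - (1 + Y ^ 2)" by (metis add_diff_cancel_left' dvd_triv_left)
  \<comment> \<open>The factor z F^4 completes F^2 to the term z F^6 of the equation and sends Y^2 =
    z^2 F^12 to z^3 F^16.\<close>
  then have "2 dvd fps_X * F ^ 4 * (F ^ 2 - (1 + Y ^ 2))" by (rule dvd_mult)
  also have "fps_X * F ^ 4 * (F ^ 2 - (1 + Y ^ 2)) =
      fps_X * F ^ 6 - (fps_X * F ^ 4 + fps_X ^ 3 * F ^ 16)"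
  proof -
    have "F ^ 4 * F ^ 2 = F ^ 6" "F ^ 4 * F ^ 12 = F ^ 16"
      by (simp_all flip: power_add)
    moreover have "fps_X * F ^ 4 * (F ^ 2 - (1 + Y ^ 2)) =
        fps_X * (F ^ 4 * F ^ 2) - (fps_X * F ^ 4 + (fps_X * fps_X ^ 2) * (F ^ 4 * F ^ 12))"
      by (simp add: Y_def power_mult_distrib ring_distribs mult.assoc mult.left_commute flip: power_mult)
    ultimately show ?thesis by (simp add: power3_eq_cube power2_eq_square mult.assoc)
  qed
  finally have "2 dvd (F - (1 + fps_X * F ^ 6)) + (fps_X * F ^ 6 - (fps_X * F ^ 4 + fps_X ^ 3 * F ^ 16))"
    using assms dvd_add by blast
  moreover have "A - (B + C) + (C - (D + E)) = A - (B + D + E)" for A B C D E :: "int fps"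
    by (simp add: algebra_simps)
  ultimately show ?thesis by metis
qed

section \<open>Numbers whose binary digits split into blocks\<close>

lemma horner_sum_append_blocks:
  "horner_sum id 2 (rev (xs @ [0, 1])) = 4 * horner_sum id 2 (rev xs) + (1::nat)"
  "horner_sum id 2 (rev (xs @ [0, 0, 1, 1])) = 16 * horner_sum id 2 (rev xs) + (3::nat)"
  by simp_all

lemma built_from_blocks_0: "built_from_blocks 0"
  unfolding built_from_blocks_def is_binary_expansion_def by (rule exI[of _ "[]"]) simp

text \<open>The last block is stripped, not the first: the low digits sit at fixed places, so this
  block shows in the residue modulo 4 or 16.\<close>

lemma built_from_blocks_rec:
  "built_from_blocks n \<longleftrightarrow> n = 0 \<or> (\<exists>m. n = 4 * m + 1 \<and> built_from_blocks m) \<or>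
     (\<exists>m. n = 16 * m + 3 \<and> built_from_blocks m)" (is "_ \<longleftrightarrow> ?R")
proof
  assume "built_from_blocks n"
  then obtain bs where bs: "set bs \<subseteq> {[0, 0, 1, 1], [0, 1]}" "is_binary_expansion (concat bs) n"
    by (auto simp: built_from_blocks_def)
  show ?R
  proof (cases bs rule: rev_cases)
    case Nil
    then show ?thesis using bs by (simp add: is_binary_expansion_def)
  next
    case (snoc cs b)
    let ?m = "horner_sum id 2 (rev (concat cs))"
    have "built_from_blocks ?m"
      unfolding built_from_blocks_def is_binary_expansion_def
      using bs snoc by (intro exI[of _ cs]) (auto simp: is_binary_expansion_def)
    moreover have "b = [0, 0, 1, 1] \<or> b = [0, 1]" using bs snoc by auto
    moreover have "n = horner_sum id 2 (rev (concat cs @ b))"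
      using bs snoc by (simp add: is_binary_expansion_def)
    ultimately show ?thesis by (auto simp only: horner_sum_append_blocks)
  qed
next
  have "built_from_blocks (horner_sum id 2 (rev (concat cs @ b)))"
    if cs: "set cs \<subseteq> {[0, 0, 1, 1], [0, 1]}" "set (concat cs) \<subseteq> {0, 1}" and b: "b \<in> {[0, 0, 1, 1], [0, 1]}"
    for cs b
    unfolding built_from_blocks_def is_binary_expansion_def
    by (rule exI[of _ "cs @ [b]"]) (use that in auto)
  then have "built_from_blocks (4 * m + 1) \<and> built_from_blocks (16 * m + 3)"
    if "built_from_blocks m" for m
    using that horner_sum_append_blocks
    unfolding built_from_blocks_def[of m] is_binary_expansion_def[of _ m]
    by (metis insertI1 insertI2)
  then show "?R \<Longrightarrow> built_from_blocks n" using built_from_blocks_0 by auto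
qed

theorem odd_nth_iff_built_from_blocks:
  fixes F :: "int fps"
  assumes "2 dvd F - (1 + fps_X * F ^ 6)"
  shows "odd (F $ n) \<longleftrightarrow> built_from_blocks n"
proof (induction n rule: less_induct)
  case (less n)
  let ?R = "1 + fps_X * F ^ 4 + fps_X ^ 3 * F ^ 16"
  have "even ((F - ?R) $ n)"
    using functional_equation_mod2[OF assms] by (simp only: two_dvd_fps_iff)
  then have eq: "odd (F $ n) \<longleftrightarrow> odd (?R $ n)" by simp
  show ?case
  proof (cases "n = 0")
    case True
    then show ?thesis using eq built_from_blocks_0 by simp
  next
    case False
    \<comment> \<open>A sum of two integers is odd iff exactly one is. Without the guard
      \<open>n \<ge> 3\<close>, truncated subtraction would read off the constant term.\<close>
    have "odd (?R $ n) \<longleftrightarrow> odd ((F ^ 4) $ (n - 1)) \<noteq> (n \<ge> 3 \<and> odd ((F ^ 16) $ (n - 3)))"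
      using False by (auto simp: fps_X_power_mult_nth)
    also have "odd ((F ^ 4) $ (n - 1)) \<longleftrightarrow> (\<exists>m. n = 4 * m + 1 \<and> built_from_blocks m)"
      (is "?L \<longleftrightarrow> ?R")
    proof
      assume ?L
      then obtain m where "n - 1 = 4 * m" "odd (F $ m)" by (auto simp: odd_fps_power4_nth)
      then show ?R using False less[of m] \<open>?L\<close> by (intro exI[of _ m]) auto
    next
      assume ?R
      then obtain m where "n = 4 * m + 1" "built_from_blocks m" by blast
      then show ?L using less[of m] by (auto simp: odd_fps_power4_nth)
    qed
    also have "(n \<ge> 3 \<and> odd ((F ^ 16) $ (n - 3))) \<longleftrightarrow> (\<exists>m. n = 16 * m + 3 \<and> built_from_blocks m)"
      (is "?L \<longleftrightarrow> ?R")
    proof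
      assume ?L
      then obtain m where "n - 3 = 16 * m" "odd (F $ m)" by (auto simp: odd_fps_power16_nth)
      then show ?R using False less[of m] \<open>?L\<close> by (intro exI[of _ m]) auto
    next
      assume ?R
      then obtain m where "n = 16 * m + 3" "built_from_blocks m" by blast
      then show ?L using less[of m] by (auto simp: odd_fps_power16_nth)
    qed
    finally have *: "odd (F $ n) \<longleftrightarrow> (\<exists>m. n = 4 * m + 1 \<and> built_from_blocks m) \<noteq>
        (\<exists>m. n = 16 * m + 3 \<and> built_from_blocks m)" using eq by simp
    \<comment> \<open>The residues 1 and 3 modulo 4 exclude each other, so the exclusive or above is
      a plain disjunction.\<close>
    have "\<not> (n = 4 * m + 1 \<and> n = 16 * m' + 3)" for m m' by presburger
    with * show ?thesis
      unfolding built_from_blocks_rec[of n] using False by blast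
  qed
qed

subsection \<open>Words acting by two permutations\<close>

text \<open>A right action: the first letter acts first, \<open>True\<close> through
  \<open>f\<close> and \<open>False\<close> through \<open>g\<close>. Inverse letters are replaced
  by powers, both maps being of finite order in all applications.\<close>

fun act :: "('a \<Rightarrow> 'a) \<Rightarrow> ('a \<Rightarrow> 'a) \<Rightarrow> bool list \<Rightarrow> 'a \<Rightarrow> 'a" where
  "act f g [] x = x"
| "act f g (b # w) x = act f g w (if b then f x else g x)"

lemma act_append [simp]: "act f g (u @ v) x = act f g v (act f g u x)"
  by (induction u arbitrary: x) auto

lemma act_replicate [simp]: "act f g (replicate n b) x = ((if b then f else g) ^^ n) x"
  by (induction n arbitrary: x) (auto simp: funpow_swap1)

lemma act_closed:
  assumes "\<And>y. y \<in> D \<Longrightarrow> f y \<in> D" "\<And>y. y \<in> D \<Longrightarrow> g y \<in> D" "x \<in> D"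
  shows "act f g w x \<in> D"
  using assms(3) by (induction w arbitrary: x) (auto simp: assms(1,2))

lemma act_cong:
  assumes "\<And>y. y \<in> D \<Longrightarrow> f y \<in> D" "\<And>y. y \<in> D \<Longrightarrow> g y \<in> D" "x \<in> D"
    and "\<And>y. y \<in> D \<Longrightarrow> f y = f' y" "\<And>y. y \<in> D \<Longrightarrow> g y = g' y"
  shows "act f g w x = act f' g' w x"
  using assms(3)
proof (induction w arbitrary: x)
  case (Cons b w)
  then show ?case using assms(1,2) by (cases b) (simp_all flip: assms(4,5))
qed simp

text \<open>A positive word for the inverse: letters in reverse order, each raised to its order
  minus one.\<close>

definition winv :: "nat \<Rightarrow> nat \<Rightarrow> bool list \<Rightarrow> bool list" where
  "winv p q w = concat (map (\<lambda>b. replicate ((if b then p else q) - 1) b) (rev w))"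

lemma winv_Nil [simp]: "winv p q [] = []"
  by (simp add: winv_def)

lemma winv_Cons [simp]:
  "winv p q (b # w) = winv p q w @ replicate ((if b then p else q) - 1) b"
  by (simp add: winv_def)

text \<open>Kept relative to a set \<open>D\<close>, because the lifted maps in the freeness proof
  behave well only on a subset of their type.\<close>

lemma act_winv:
  assumes D: "\<And>y. y \<in> D \<Longrightarrow> f y \<in> D" "\<And>y. y \<in> D \<Longrightarrow> g y \<in> D" "x \<in> D"
    and "\<And>y. y \<in> D \<Longrightarrow> (f ^^ p) y = y" "\<And>y. y \<in> D \<Longrightarrow> (g ^^ q) y = y" "p > 0" "q > 0"
  shows "act f g (winv p q w) (act f g w x) = x"
  using \<open>x \<in> D\<close>
proof (induction w arbitrary: x)
  case (Cons b w)
  have "((if b then f else g) ^^ ((if b then p else q) - 1)) ((if b then f else g) x) = x"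
    using Cons.prems assms(4-7) funpow_swap1[of f "p - 1" x] funpow_swap1[of g "q - 1" x]
    by (cases b) (cases p; cases q; simp add: funpow_swap1)+
  moreover have "(if b then f else g) x = (if b then f x else g x)" by simp
  moreover have "act f g (winv p q w) (act f g w (if b then f x else g x)) = (if b then f x else g x)"
    using Cons D by simp
  ultimately show ?case by simp
qed simp

lemma winv_act:
  assumes D: "\<And>y. y \<in> D \<Longrightarrow> f y \<in> D" "\<And>y. y \<in> D \<Longrightarrow> g y \<in> D" "x \<in> D"
    and "\<And>y. y \<in> D \<Longrightarrow> (f ^^ p) y = y" "\<And>y. y \<in> D \<Longrightarrow> (g ^^ q) y = y" "p > 0" "q > 0"
  shows "act f g w (act f g (winv p q w) x) = x"
  using \<open>x \<in> D\<close>
proof (induction w arbitrary: x)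
  case (Cons b w)
  let ?h = "if b then f else g" and ?r = "if b then p else q"
  let ?y = "act f g (winv p q w) x"
  have y: "?y \<in> D" using Cons.prems D by (intro act_closed) auto
  have "?h ((?h ^^ (?r - 1)) ?y) = (?h ^^ Suc (?r - 1)) ?y" by simp
  also have "\<dots> = (?h ^^ ?r) ?y" using assms(6,7) by simp
  also have "\<dots> = ?y" using y assms(4,5) by auto
  finally have "?h ((?h ^^ (?r - 1)) ?y) = ?y" .
  then show ?case using Cons by (cases b) auto
qed simp

(* For p = 1 the only element is the identity, so that a pair in free_actions p 1 A is a free
   action of the cyclic group of order p alone. *)
definition free_cyc :: "nat \<Rightarrow> 'a set \<Rightarrow> ('a \<Rightarrow> 'a) set" where
  "free_cyc p A = {f. f permutes A \<and> (\<forall>x\<in>A. (f ^^ p) x = x \<and> (\<forall>i. 0 < i \<and> i < p \<longrightarrow> (f ^^ i) x \<noteq> x))}"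

definition free_actions :: "nat \<Rightarrow> nat \<Rightarrow> 'a set \<Rightarrow> (('a \<Rightarrow> 'a) \<times> ('a \<Rightarrow> 'a)) set" where
  "free_actions p q A = free_cyc p A \<times> free_cyc q A"

text \<open>Positive words reach the whole group orbit once both maps have positive finite order,
  since \<open>winv\<close> supplies inverses.\<close>

definition orb :: "('a \<Rightarrow> 'a) \<Rightarrow> ('a \<Rightarrow> 'a) \<Rightarrow> 'a \<Rightarrow> 'a set" where
  "orb f g x = range (\<lambda>w. act f g w x)"

definition transitive_actions :: "nat \<Rightarrow> nat \<Rightarrow> 'a set \<Rightarrow> 'a \<Rightarrow> (('a \<Rightarrow> 'a) \<times> ('a \<Rightarrow> 'a)) set" where
  "transitive_actions p q A x = {(f, g) \<in> free_actions p q A. orb f g x = A}"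

lemma free_cycD:
  assumes "f \<in> free_cyc p A"
  shows "f permutes A" "x \<in> A \<Longrightarrow> (f ^^ p) x = x"
    "x \<in> A \<Longrightarrow> 0 < i \<Longrightarrow> i < p \<Longrightarrow> (f ^^ i) x \<noteq> x"
  using assms by (auto simp: free_cyc_def)

lemma free_cyc_closed: "f \<in> free_cyc p A \<Longrightarrow> x \<in> A \<Longrightarrow> f x \<in> A"
  by (simp add: free_cyc_def permutes_in_image)

lemma finite_free_cyc [simp]: "finite A \<Longrightarrow> finite (free_cyc p A)"
  by (rule finite_subset[OF _ finite_permutations[of A]]) (auto simp: free_cyc_def)

lemma finite_free_actions [simp]: "finite A \<Longrightarrow> finite (free_actions p q A)"
  by (simp add: free_actions_def)

lemma finite_transitive_actions [simp]: "finite A \<Longrightarrow> finite (transitive_actions p q A x)"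
  by (rule finite_subset[OF _ finite_free_actions[of A p q]]) (auto simp: transitive_actions_def)

lemma orb_self [simp]: "x \<in> orb f g x"
  unfolding orb_def by (rule image_eqI[of _ _ "[]"]) auto

lemma orb_closed: "y \<in> orb f g x \<Longrightarrow> f y \<in> orb f g x" "y \<in> orb f g x \<Longrightarrow> g y \<in> orb f g x"
proof -
  assume "y \<in> orb f g x"
  then obtain w where w: "y = act f g w x" by (auto simp: orb_def)
  have "f y = act f g (w @ [True]) x" "g y = act f g (w @ [False]) x" using w by simp_all
  then show "f y \<in> orb f g x" "g y \<in> orb f g x" by (auto simp only: orb_def)
qed

lemma orb_subset:
  assumes "\<And>y. y \<in> D \<Longrightarrow> f y \<in> D" "\<And>y. y \<in> D \<Longrightarrow> g y \<in> D" "x \<in> D"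
  shows "orb f g x \<subseteq> D"
  unfolding orb_def by (intro image_subsetI act_closed) (auto intro: assms)

subsection \<open>Conjugation\<close>

text \<open>Relabelling by a bijection of the whole type, so that conjugation by the inverse
  bijection undoes it.\<close>

definition conj_by :: "('a \<Rightarrow> 'a) \<Rightarrow> ('a \<Rightarrow> 'a) \<Rightarrow> 'a \<Rightarrow> 'a" where
  "conj_by s f = s \<circ> f \<circ> inv_into UNIV s"

lemma conj_by_apply: "bij s \<Longrightarrow> conj_by s f (s x) = s (f x)"
  by (simp add: conj_by_def bij_is_inj)

lemma conj_by_funpow: "bij s \<Longrightarrow> (conj_by s f ^^ i) (s x) = s ((f ^^ i) x)"
  by (induction i) (simp_all add: conj_by_apply)

lemma act_conj_by: "bij s \<Longrightarrow> act (conj_by s f) (conj_by s g) w (s x) = s (act f g w x)"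
  by (induction w arbitrary: x) (simp_all add: conj_by_apply)

lemma orb_conj_by: "bij s \<Longrightarrow> orb (conj_by s f) (conj_by s g) (s x) = s ` orb f g x"
  by (simp add: orb_def act_conj_by image_image)

lemma conj_by_inv: "bij s \<Longrightarrow> conj_by (inv_into UNIV s) (conj_by s f) = f"
  by (auto simp: conj_by_def fun_eq_iff inv_inv_eq bij_is_inj)

lemma conj_by_free_cyc:
  assumes s: "bij s" and f: "f \<in> free_cyc p A"
  shows "conj_by s f \<in> free_cyc p (s ` A)"
proof -
  have "conj_by s f permutes s ` A"
  proof (rule bij_imp_permutes)
    have "bij_betw f A A" using f by (auto simp: free_cyc_def permutes_imp_bij)
    moreover have "bij_betw s A (s ` A)" using s by (meson bij_betw_subset bij_is_inj inj_on_imp_bij_betw inj_on_subset subset_UNIV)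
    moreover have "bij_betw (inv_into UNIV s) (s ` A) A"
      using s by (auto simp: bij_betw_def bij_is_inj inj_on_def image_image)
    ultimately show "bij_betw (conj_by s f) (s ` A) (s ` A)"
      unfolding conj_by_def by (meson bij_betw_trans)
  next
    fix y assume "y \<notin> s ` A"
    then obtain x where x: "y = s x" "x \<notin> A" using s by (metis bij_pointE imageI)
    then show "conj_by s f y = y" using s f by (auto simp: conj_by_apply free_cyc_def permutes_not_in)
  qed
  then show ?thesis using f s by (auto simp: free_cyc_def conj_by_funpow bij_is_inj inj_eq)
qed

lemma conj_by_free_actions:
  "bij s \<Longrightarrow> fg \<in> free_actions p q A \<Longrightarrow> map_prod (conj_by s) (conj_by s) fg \<in> free_actions p q (s ` A)"
  by (auto simp: free_actions_def conj_by_free_cyc)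

lemma conj_by_transitive_actions:
  "bij s \<Longrightarrow> fg \<in> transitive_actions p q A x \<Longrightarrow>
     map_prod (conj_by s) (conj_by s) fg \<in> transitive_actions p q (s ` A) (s x)"
  using conj_by_free_actions[of s fg p q A] by (cases fg) (simp add: transitive_actions_def orb_conj_by)

lemma card_free_cyc_bij: 
  fixes s :: "'a \<Rightarrow> 'a"
  shows "bij s \<Longrightarrow> card (free_cyc p (s ` A)) = card (free_cyc p A)"
proof -
  assume s: "bij s"
  have "bij_betw (conj_by s) (free_cyc p A) (free_cyc p (s ` A))"
  proof (rule bij_betw_byWitness[where f' = "conj_by (inv_into UNIV s)"])
    show "conj_by (inv_into UNIV s) ` free_cyc p (s ` A) \<subseteq> free_cyc p A"
      using conj_by_free_cyc[of "inv_into UNIV s" _ p "s ` A"] s by (auto simp: bij_imp_bij_inv image_image bij_is_inj)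
    show "\<forall>f\<in>free_cyc p (s ` A). conj_by s (conj_by (inv_into UNIV s) f) = f"
      using conj_by_inv[of "inv_into UNIV s"] s by (simp add: bij_imp_bij_inv inv_inv_eq)
  qed (auto simp: conj_by_inv s conj_by_free_cyc)
  then show ?thesis by (simp add: bij_betw_same_card)
qed

lemma card_transitive_actions_bij:
  
  fixes s :: "'a \<Rightarrow> 'a"
  shows "bij s \<Longrightarrow> card (transitive_actions p q (s ` A) (s x)) = card (transitive_actions p q A x)"
proof -
  assume s: "bij s"
  let ?c = "\<lambda>s. map_prod (conj_by s) (conj_by s)"
  have "bij_betw (?c s) (transitive_actions p q A x) (transitive_actions p q (s ` A) (s x))"
  proof (rule bij_betw_byWitness[where f' = "?c (inv_into UNIV s)"])
    have "bij (inv_into UNIV s)" "inv_into UNIV s ` s ` A = A" "inv_into UNIV s (s x) = x"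
      using s by (simp_all add: bij_imp_bij_inv image_image bij_is_inj)
    then show "?c (inv_into UNIV s) ` transitive_actions p q (s ` A) (s x) \<subseteq> transitive_actions p q A x"
      using conj_by_transitive_actions[of "inv_into UNIV s" _ p q "s ` A" "s x"] by (intro image_subsetI) metis
    show "?c s ` transitive_actions p q A x \<subseteq> transitive_actions p q (s ` A) (s x)"
      by (rule image_subsetI) (rule conj_by_transitive_actions[OF s])
    have "conj_by (inv_into UNIV s) (conj_by s f) = f" "conj_by s (conj_by (inv_into UNIV s) f) = f" for f :: "'a \<Rightarrow> 'a"
      using conj_by_inv[OF bij_imp_bij_inv[OF s], of f] conj_by_inv[OF s, of f] inv_inv_eq[OF s]
      by simp_all
    then show "\<forall>fg\<in>transitive_actions p q (s ` A) (s x). ?c s (?c (inv_into UNIV s) fg) = fg"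
      "\<forall>fg\<in>transitive_actions p q A x. ?c (inv_into UNIV s) (?c s fg) = fg"
      by (simp_all add: prod.map_comp comp_def prod.map_ident)
  qed
  then show ?thesis by (simp add: bij_betw_same_card)
qed

text \<open>Conjugation wants a bijection of the whole type: one from \<open>A\<close> to
  \<open>B\<close> is completed by one from \<open>B - A\<close> to \<open>A - B\<close> and by the
  identity elsewhere.\<close>

lemma obtain_bij_image:
  fixes A B :: "'a set"
  assumes "finite A" "finite B" "card A = card B"
  obtains s where "bij s" "s ` A = B"
proof -
  obtain h where h: "bij_betw h A B" using assms finite_same_card_bij by blast
  have "card (B - A) = card (A - B)"
    using assms by (simp add: card_Diff_subset_Int Int_commute)
  then obtain k where k: "bij_betw k (B - A) (A - B)" using assms finite_same_card_bij by (metis finite_Diff)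
  have "bij_betw (\<lambda>x. if x \<in> A then h x else k x) (A \<union> (B - A)) (B \<union> (A - B))"
    by (rule bij_betw_disjoint_Un[OF h k]) auto
  moreover have "bij_betw id (- (A \<union> B)) (- (A \<union> B))" by simp
  ultimately have "bij_betw (\<lambda>x. if x \<in> A \<union> (B - A) then (if x \<in> A then h x else k x) else id x)
      ((A \<union> (B - A)) \<union> - (A \<union> B)) ((B \<union> (A - B)) \<union> - (A \<union> B))" (is "bij_betw ?s _ _")
    by (rule bij_betw_disjoint_Un) auto
  moreover have "A \<union> (B - A) \<union> - (A \<union> B) = UNIV" "B \<union> (A - B) \<union> - (A \<union> B) = UNIV" by auto
  ultimately have "bij ?s" by metis
  moreover have "?s ` A = B" using h by (auto simp: bij_betw_def)
  ultimately show thesis using that by blast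
qed

lemma obtain_bij_image_point:
  fixes A B :: "'a set"
  assumes "finite A" "finite B" "card A = card B" "x \<in> A" "y \<in> B"
  obtains s where "bij s" "s ` A = B" "s x = y"
proof -
  obtain s where s: "bij s" "s ` A = B" using obtain_bij_image assms by metis
  let ?t = "Transposition.transpose (s x) y"
  have "bij (?t \<circ> s)" using s(1) by (rule bij_comp) simp
  moreover have "?t permutes B" using s assms by (intro permutes_swap_id) auto
  then have "(?t \<circ> s) ` A = B" using s by (metis image_comp permutes_image)
  ultimately show thesis using that by simp
qed

lemma card_free_cyc_eq:
  fixes A B :: "'a set"
  assumes "finite A" "finite B" "card A = card B"
  shows "card (free_cyc p A) = card (free_cyc p B)"
proof -
  obtain s where "bij s" "s ` A = B" using obtain_bij_image[OF assms] .
  then show ?thesis using card_free_cyc_bij[of s p A] by simp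
qed

lemma card_transitive_actions_eq:
  fixes A B :: "'a set"
  assumes "finite A" "finite B" "card A = card B" "x \<in> A" "y \<in> B"
  shows "card (transitive_actions p q A x) = card (transitive_actions p q B y)"
proof -
  obtain s where "bij s" "s ` A = B" "s x = y" using obtain_bij_image_point[OF assms] .
  then show ?thesis using card_transitive_actions_bij[of s p q A x] by simp
qed

lemma free_actionsD:
  assumes "(f, g) \<in> free_actions p q A"
  shows "f permutes A" "g permutes A" "y \<in> A \<Longrightarrow> f y \<in> A" "y \<in> A \<Longrightarrow> g y \<in> A"
    "y \<in> A \<Longrightarrow> (f ^^ p) y = y" "y \<in> A \<Longrightarrow> (g ^^ q) y = y"
  using assms free_cyc_closed free_cycD(1,2) by (auto simp: free_actions_def)

(* Two words reaching the same point differ by a word in the stabiliser, so the stabiliser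
   determines the action up to relabelling of the points. *)
lemma act_eq_of_same_stabiliser:
  assumes fg: "(f, g) \<in> free_actions p q A" and fg': "(f', g') \<in> free_actions p q A"
    and x: "x \<in> A" and pq: "p > 0" "q > 0"
    and stab: "\<And>w. act f g w x = x \<longleftrightarrow> act f' g' w x = x"
    and eq: "act f g u x = act f g v x"
  shows "act f' g' u x = act f' g' v x"
proof -
  note F = free_actionsD[OF fg] and F' = free_actionsD[OF fg']
  have "act f g (winv p q v) (act f g v x) = x"
    by (rule act_winv[where D = A]) (use F x pq in auto)
  then have "act f g (u @ winv p q v) x = x" by (simp add: eq)
  then have 1: "act f' g' (winv p q v) (act f' g' u x) = x"
    using stab[of "u @ winv p q v"] by simp
  have "act f' g' u x \<in> A" by (rule act_closed) (use F' x in auto)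
  then have "act f' g' v (act f' g' (winv p q v) (act f' g' u x)) = act f' g' u x"
    by (intro winv_act[where D = A]) (use F' pq in auto)
  then show ?thesis by (simp add: 1)
qed

text \<open>The permutations of \<open>A\<close> fixing \<open>x\<close> act by conjugation, freely
  and transitively, on the transitive actions with a given stabiliser of \<open>x\<close>.\<close>

lemma card_actions_same_stabiliser:
  assumes fg0: "(f0, g0) \<in> transitive_actions p q A x" and A: "finite A" "x \<in> A"
    and pq: "p > 0" "q > 0"
  shows "card {(f, g) \<in> transitive_actions p q A x. \<forall>w. act f g w x = x \<longleftrightarrow> act f0 g0 w x = x}
    = fact (card A - 1)" (is "card ?S = _")
proof -
  have fa0: "(f0, g0) \<in> free_actions p q A" and orb0: "orb f0 g0 x = A"
    using fg0 by (auto simp: transitive_actions_def)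
  define c where "c s = (conj_by s f0, conj_by s g0)" for s
  define P where "P = {s. s permutes A - {x}}"
  have P: "s permutes A" "bij s" "s x = x" "s ` A = A" if "s \<in> P" for s
  proof -
    have s: "s permutes A - {x}" using that by (simp add: P_def)
    show "s permutes A" by (rule permutes_subset[OF s]) auto
    then show "bij s" "s ` A = A" by (simp_all add: permutes_bij permutes_image)
    show "s x = x" using s by (simp add: permutes_not_in)
  qed
  have reach: "\<exists>w. y = act f0 g0 w x" if "y \<in> A" for y
    using that orb0 by (auto simp: orb_def)
  have "c ` P = ?S"
  proof (intro equalityI subsetI)
    fix fg assume "fg \<in> c ` P"
    then obtain s where s: "s \<in> P" "fg = c s" by auto
    note Ps = P[OF s(1)]
    have "c s \<in> transitive_actions p q A x"
      using conj_by_transitive_actions[OF Ps(2) fg0] Ps by (simp add: c_def)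
    moreover have "act (conj_by s f0) (conj_by s g0) w x = s (act f0 g0 w x)" for w
      using act_conj_by[OF Ps(2), of f0 g0 w x] Ps by simp
    then have "act (conj_by s f0) (conj_by s g0) w x = x \<longleftrightarrow> act f0 g0 w x = x" for w
      using Ps by (metis bij_pointE)
    ultimately show "fg \<in> ?S" using s by (simp add: c_def)
  next
    fix fg assume "fg \<in> ?S"
    then obtain f g where fg: "fg = (f, g)" "(f, g) \<in> transitive_actions p q A x"
      and stab: "\<And>w. act f g w x = x \<longleftrightarrow> act f0 g0 w x = x" by auto
    have fa: "(f, g) \<in> free_actions p q A" and orb: "orb f g x = A"
      using fg by (auto simp: transitive_actions_def)
    \<comment> \<open>An arbitrary word leading from \<open>x\<close> to \<open>y\<close> in the
      base action; equality of stabilisers makes the relabelling \<open>s\<close> below independent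
      of the choice.\<close>
    define wd where "wd y = (SOME w. y = act f0 g0 w x)" for y
    have wd: "act f0 g0 (wd y) x = y" if "y \<in> A" for y
      using someI_ex[OF reach[OF that]] by (simp add: wd_def)
    define s where "s y = (if y \<in> A then act f g (wd y) x else y)" for y
    have act0_in: "act f0 g0 w x \<in> A" and act_in: "act f g w x \<in> A" for w
      using orb0 orb by (auto simp: orb_def)
    have s: "s (act f0 g0 w x) = act f g w x" for w
    proof -
      have "act f g (wd (act f0 g0 w x)) x = act f g w x"
        by (rule act_eq_of_same_stabiliser[OF fa0 fa A(2) pq]) (simp_all add: stab wd act0_in)
      then show ?thesis by (simp add: s_def act0_in)
    qed
    have "inj_on s A"
    proof (rule inj_onI)
      fix y z assume yz: "y \<in> A" "z \<in> A" "s y = s z"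
      then have "act f0 g0 (wd y) x = act f0 g0 (wd z) x"
        by (intro act_eq_of_same_stabiliser[OF fa fa0 A(2) pq]) (simp_all add: stab s_def)
      then show "y = z" using yz by (simp add: wd)
    qed
    moreover have "s ` A \<subseteq> A" by (auto simp: s_def act_in)
    ultimately have "s permutes A"
      using A(1) endo_inj_surj[of A s] by (intro bij_imp_permutes) (auto simp: bij_betw_def s_def)
    moreover have sx: "s x = x" using s[of "[]"] by simp
    ultimately have sP: "s \<in> P" unfolding P_def by (auto intro: permutes_superset)
    note Ps = P[OF sP]
    have "conj_by s h0 = h" if h: "h permutes A" "h0 permutes A" and
        step: "\<And>y. y \<in> A \<Longrightarrow> s (h0 y) = h (s y)" for h h0
    proof
      fix z
      obtain y where z: "z = s y" using Ps(2) by (metis bij_pointE)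
      show "conj_by s h0 z = h z"
        unfolding z conj_by_apply[OF Ps(2)]
        by (cases "y \<in> A") (use step h Ps(1) in \<open>simp_all add: permutes_not_in permutes_in_image\<close>)
    qed
    moreover have "s (f0 y) = f (s y)" "s (g0 y) = g (s y)" if y: "y \<in> A" for y
    proof -
      obtain w where w: "y = act f0 g0 w x" using reach[OF y] by blast
      show "s (f0 y) = f (s y)" using s[of "w @ [True]"] by (simp add: w s)
      show "s (g0 y) = g (s y)" using s[of "w @ [False]"] by (simp add: w s)
    qed
    ultimately have "fg = c s"
      using free_actionsD(1,2)[OF fa] free_actionsD(1,2)[OF fa0] by (simp add: c_def fg)
    then show "fg \<in> c ` P" using sP by blast
  qed
  \<comment> \<open>Every point is reached from the fixed point \<open>x\<close> by a word, so the
    conjugated action determines the relabelling.\<close>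
  moreover have "inj_on c P"
  proof (rule inj_onI)
    fix s t assume st: "s \<in> P" "t \<in> P" "c s = c t"
    show "s = t"
    proof
      fix y
      show "s y = t y"
      proof (cases "y \<in> A")
        case True
        then obtain w where "y = act f0 g0 w x" using reach by blast
        then show ?thesis
          using act_conj_by[OF P(2)[OF st(1)], of f0 g0 w x] act_conj_by[OF P(2)[OF st(2)], of f0 g0 w x]
            P(3)[OF st(1)] P(3)[OF st(2)] st(3) by (simp add: c_def)
      qed (simp add: permutes_not_in[OF P(1)[OF st(1)]] permutes_not_in[OF P(1)[OF st(2)]])
    qed
  qed
  ultimately have "card ?S = card P" by (metis card_image)
  also have "\<dots> = fact (card A - 1)"
    unfolding P_def by (rule card_permutations) (use A in auto)
  finally show ?thesis .
qed

subsection \<open>Splitting off an orbit\<close>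

text \<open>On a finite set, mapping \<open>B\<close> into itself injectively means mapping it onto
  itself; hence the complement is invariant too.\<close>

lemma free_cyc_restrict:
  assumes f: "f \<in> free_cyc p A" and A: "finite A" and B: "B \<subseteq> A" "\<And>y. y \<in> B \<Longrightarrow> f y \<in> B"
  shows "restrict_id f B \<in> free_cyc p B" "restrict_id f (A - B) \<in> free_cyc p (A - B)"
proof -
  have fA: "f permutes A" using f by (rule free_cycD)
  have "finite B" using A B finite_subset by blast
  then have fB: "f ` B = B"
    using B fA by (intro endo_inj_surj) (auto intro: permutes_inj_on)
  have "f ` (A - B) = A - B"
    using fA fB by (metis image_set_diff permutes_image permutes_inj)
  then have bij: "bij_betw f B B" "bij_betw f (A - B) (A - B)"
    using fB fA by (auto simp: bij_betw_def intro: permutes_inj_on)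
  have "restrict_id f C \<in> free_cyc p C" if C: "C \<subseteq> A" "bij_betw f C C" for C
  proof -
    have "(restrict_id f C ^^ i) y = (f ^^ i) y \<and> (f ^^ i) y \<in> C" if "y \<in> C" for i y
      using that C(2) by (induction i) (auto simp: bij_betw_def)
    then show ?thesis using f C by (auto simp: free_cyc_def intro!: permutes_restrict_id)
  qed
  then show "restrict_id f B \<in> free_cyc p B" "restrict_id f (A - B) \<in> free_cyc p (A - B)"
    using bij B by auto
qed

lemma free_cyc_union:
  assumes f: "f \<in> free_cyc p B" and g: "g \<in> free_cyc p C" and BC: "B \<inter> C = {}"
  shows "(\<lambda>y. if y \<in> B then f y else g y) \<in> free_cyc p (B \<union> C)" (is "?h \<in> _")
proof -
  have "bij_betw ?h (B \<union> C) (B \<union> C)"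
    using f g BC by (intro bij_betw_disjoint_Un) (auto dest: free_cycD(1) intro: permutes_imp_bij)
  moreover have "?h y = y" if "y \<notin> B \<union> C" for y using that g by (auto simp: free_cyc_def permutes_not_in)
  ultimately have "?h permutes B \<union> C" by (intro bij_imp_permutes) auto
  moreover have "(?h ^^ i) y = (f ^^ i) y \<and> (f ^^ i) y \<in> B" if "y \<in> B" for i y
    using that f by (induction i) (auto simp: free_cyc_closed)
  moreover have "(?h ^^ i) y = (g ^^ i) y \<and> (g ^^ i) y \<in> C" if "y \<in> C" for i y
    using that g BC by (induction i) (auto simp: free_cyc_closed)
  ultimately show ?thesis using f g by (auto simp: free_cyc_def)
qed

text \<open>Restriction to \<open>B\<close> and to its complement is inverted by gluing;
  transitivity is required on \<open>B\<close> only.\<close>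

lemma card_actions_with_orbit:
  assumes A: "finite A" and B: "x \<in> B" "B \<subseteq> A"
  shows "card {(f, g) \<in> free_actions p q A. orb f g x = B} =
    card (transitive_actions p q B x) * card (free_actions p q (A - B))"
proof -
  define sp where "sp = (\<lambda>(f, g). ((restrict_id f B, restrict_id g B),
      (restrict_id f (A - B), restrict_id g (A - B :: 'a set))))"
  define glue where "glue = (\<lambda>f g y. if y \<in> B then f y else (g y :: 'a))"
  define jn where "jn = (\<lambda>((f, g), (f', g')). (glue f f', glue g g'))"
  have "bij_betw sp {(f, g) \<in> free_actions p q A. orb f g x = B}
      (transitive_actions p q B x \<times> free_actions p q (A - B))"
  proof (rule bij_betw_byWitness[where f' = jn])
    have "glue (restrict_id f B) (restrict_id f (A - B)) = f" if "f permutes A" for f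
      using that by (auto simp: glue_def fun_eq_iff restrict_id_def permutes_not_in)
    then show "\<forall>fg\<in>{(f, g) \<in> free_actions p q A. orb f g x = B}. jn (sp fg) = fg"
      by (auto simp: jn_def sp_def free_actionsD(1,2))
    have glue: "restrict_id (glue f g) B = f" "restrict_id (glue f g) (A - B) = g"
      if "f permutes B" "g permutes A - B" for f g
      using that by (auto simp: glue_def fun_eq_iff restrict_id_def permutes_not_in)
    show "\<forall>fg\<in>transitive_actions p q B x \<times> free_actions p q (A - B). sp (jn fg) = fg"
    proof (intro ballI)
      fix h assume "h \<in> transitive_actions p q B x \<times> free_actions p q (A - B)"
      then obtain f g f' g' where h: "h = ((f, g), (f', g'))" and
        fg: "(f, g) \<in> free_actions p q B" "(f', g') \<in> free_actions p q (A - B)"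
        by (auto simp: transitive_actions_def)
      show "sp (jn h) = h"
        using glue free_actionsD(1,2)[OF fg(1)] free_actionsD(1,2)[OF fg(2)] by (simp add: h jn_def sp_def)
    qed
    show "sp ` {(f, g) \<in> free_actions p q A. orb f g x = B} \<subseteq>
        transitive_actions p q B x \<times> free_actions p q (A - B)"
    proof (rule image_subsetI)
      fix fg assume "fg \<in> {(f, g) \<in> free_actions p q A. orb f g x = B}"
      then obtain f g where fg: "fg = (f, g)" "(f, g) \<in> free_actions p q A" and o: "orb f g x = B" by auto
      have cl: "f y \<in> B" "g y \<in> B" if "y \<in> B" for y using that orb_closed[of y f g x] by (auto simp: o)
      have "act (restrict_id f B) (restrict_id g B) w x = act f g w x" for w
        by (rule act_cong[symmetric, of B]) (auto simp: cl B)
      then have "orb (restrict_id f B) (restrict_id g B) x = B" using o by (simp add: orb_def)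
      then show "sp fg \<in> transitive_actions p q B x \<times> free_actions p q (A - B)"
        using fg cl B A by (auto simp: sp_def transitive_actions_def free_actions_def intro!: free_cyc_restrict)
    qed
    show "jn ` (transitive_actions p q B x \<times> free_actions p q (A - B)) \<subseteq>
        {(f, g) \<in> free_actions p q A. orb f g x = B}"
    proof (rule image_subsetI)
      fix h assume "h \<in> transitive_actions p q B x \<times> free_actions p q (A - B)"
      then obtain f g f' g' where h: "h = ((f, g), (f', g'))" and
        fg: "(f, g) \<in> free_actions p q B" "orb f g x = B" "(f', g') \<in> free_actions p q (A - B)"
        by (auto simp: transitive_actions_def)
      have "B \<union> (A - B) = A" using B by auto
      then have "(glue f f', glue g g') \<in> free_actions p q A"
        using fg free_cyc_union[of _ p B _ "A - B"] free_cyc_union[of _ q B _ "A - B"]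
        by (auto simp: free_actions_def glue_def)
      moreover have "act (glue f f') (glue g g') w x = act f g w x" for w
        by (rule act_cong[symmetric, of B]) (use B free_actionsD(3,4)[OF fg(1)] in \<open>auto simp: glue_def\<close>)
      ultimately show "jn h \<in> {(f, g) \<in> free_actions p q A. orb f g x = B}"
        using fg(2) by (simp add: jn_def h orb_def)
    qed
  qed
  then show ?thesis by (simp add: bij_betw_same_card card_cartesian_product)
qed

lemma card_free_actions_split:
  assumes A: "finite A" "x \<in> A"
  shows "card (free_actions p q A) =
    (\<Sum>B | x \<in> B \<and> B \<subseteq> A. card (transitive_actions p q B x) * card (free_actions p q (A - B)))"
proof -
  let ?T = "{B. x \<in> B \<and> B \<subseteq> A}"
  have fin: "finite ?T" by (rule finite_subset[of _ "Pow A"]) (use A in auto)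
  have "free_actions p q A = (\<Union>B\<in>?T. {(f, g) \<in> free_actions p q A. orb f g x = B})"
  proof (intro equalityI subsetI)
    fix fg assume fg: "fg \<in> free_actions p q A"
    then have "orb (fst fg) (snd fg) x \<subseteq> A"
      using free_actionsD(3,4)[of "fst fg" "snd fg" p q A] A by (intro orb_subset) auto
    then show "fg \<in> (\<Union>B\<in>?T. {(f, g) \<in> free_actions p q A. orb f g x = B})"
      using fg by (auto simp: split_beta)
  qed auto
  then have "card (free_actions p q A) = card (\<Union>B\<in>?T. {(f, g) \<in> free_actions p q A. orb f g x = B})"
    by (rule arg_cong)
  also have "\<dots> = (\<Sum>B\<in>?T. card {(f, g) \<in> free_actions p q A. orb f g x = B})"
  proof (rule card_UN_disjoint[OF fin])
    show "\<forall>B\<in>?T. finite {(f, g) \<in> free_actions p q A. orb f g x = B}"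
      by (intro ballI finite_subset[OF _ finite_free_actions[OF A(1), of p q]]) auto
  qed auto
  also have "\<dots> = (\<Sum>B\<in>?T. card (transitive_actions p q B x) * card (free_actions p q (A - B)))"
    by (rule sum.cong) (use A in \<open>auto simp: card_actions_with_orbit\<close>)
  finally show ?thesis .
qed

subsection \<open>Counting\<close>

definition num_free :: "nat \<Rightarrow> nat \<Rightarrow> nat" where
  "num_free p n = card (free_cyc p {..<n})"

definition num_transitive :: "nat \<Rightarrow> nat \<Rightarrow> nat \<Rightarrow> nat" where
  "num_transitive p q n = card (transitive_actions p q {..<n} 0)"

lemma card_free_actions: 
  fixes A :: "nat set"
  shows "finite A \<Longrightarrow> card (free_actions p q A) = num_free p (card A) * num_free q (card A)"
  using card_free_cyc_eq[of A "{..<card A}"]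
  by (simp add: num_free_def free_actions_def card_cartesian_product)

lemma card_transitive_actions:
  fixes A :: "nat set"
  shows "finite A \<Longrightarrow> x \<in> A \<Longrightarrow> card (transitive_actions p q A x) = num_transitive p q (card A)"
  using card_transitive_actions_eq[of A "{..<card A}" x 0]
  by (auto simp: num_transitive_def card_gt_0_iff)

lemma sum_over_Pow_by_card:
  assumes "finite A"
  shows "(\<Sum>B\<in>Pow A. F (card B)) = (\<Sum>k\<le>card A. (card A choose k) * (F k :: nat))"
proof -
  have "(\<Sum>B\<in>Pow A. F (card B)) = (\<Sum>k\<le>card A. \<Sum>B | B \<in> Pow A \<and> card B = k. F (card B))"
    by (rule sum.group[symmetric]) (use assms in \<open>auto intro: card_mono\<close>)
  also have "\<dots> = (\<Sum>k\<le>card A. (card A choose k) * F k)"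
    by (intro sum.cong) (use n_subsets[OF assms] in auto)
  finally show ?thesis .
qed

text \<open>The point n of \<open>{..<Suc n}\<close> is distinguished. Its orbit is n together with
  k of the other n points, whence the binomial coefficient and the size
  \<open>Suc k\<close>.\<close>

lemma num_free_recurrence:
  "num_free p (Suc n) * num_free q (Suc n) =
     (\<Sum>k\<le>n. (n choose k) * (num_transitive p q (Suc k) * (num_free p (n - k) * num_free q (n - k))))"
proof -
  define A where "A = {..<Suc n}"
  have A: "finite A" "n \<in> A" "card A = Suc n" "finite (A - {n})" "card (A - {n}) = n"
    by (simp_all add: A_def)
  define F where "F k = num_transitive p q (Suc k) * (num_free p (n - k) * num_free q (n - k))" for k
  have "num_free p (Suc n) * num_free q (Suc n) = card (free_actions p q A)"
    using A by (simp add: card_free_actions)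
  also have "\<dots> = (\<Sum>B | n \<in> B \<and> B \<subseteq> A. card (transitive_actions p q B n) * card (free_actions p q (A - B)))"
    using A by (intro card_free_actions_split) auto
  also have "\<dots> = (\<Sum>B\<in>Pow (A - {n}). F (card B))"
  proof (rule sum.reindex_bij_witness[where i = "insert n" and j = "\<lambda>B. B - {n}"])
    fix B assume B: "B \<in> {B. n \<in> B \<and> B \<subseteq> A}"
    then have fin: "finite B" using A finite_subset by auto
    then have "card B = Suc (card (B - {n}))" using B card.remove[of B n] by auto
    moreover have "card (A - B) = card A - card B" using B fin by (intro card_Diff_subset) auto
    ultimately show "F (card (B - {n})) = card (transitive_actions p q B n) * card (free_actions p q (A - B))"
      using B fin A by (simp add: F_def card_transitive_actions card_free_actions)
  qed (use A in auto)
  also have "\<dots> = (\<Sum>k\<le>n. (n choose k) * F k)"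
    using sum_over_Pow_by_card[OF A(4), of F] A by simp
  finally show ?thesis by (simp add: F_def)
qed

section \<open>Explicit counts for one cyclic group\<close>

lemma free_cyc_1: "free_cyc (Suc 0) A = {id}"
proof -
  have "f = id" if "f permutes A" "\<forall>x\<in>A. f x = x" for f
    using that by (metis eq_id_iff permutes_not_in)
  then show ?thesis by (auto simp: free_cyc_def)
qed

lemma num_free_1: "num_free (Suc 0) n = 1"
  by (simp add: num_free_def free_cyc_1)

lemma num_free_0: "num_free p 0 = 1"
  by (auto simp: num_free_def free_cyc_def)

lemma funpow_mod_on:
  assumes "\<And>y. y \<in> D \<Longrightarrow> f y \<in> D" "\<And>y. y \<in> D \<Longrightarrow> (f ^^ p) y = y" "x \<in> D"
  shows "(f ^^ m) x = (f ^^ (m mod p)) x"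
proof -
  have "((f ^^ p) ^^ k) x = x" for k
    by (induction k) (simp_all add: assms(2,3))
  then have "(f ^^ (p * k)) x = x" for k by (simp add: funpow_mult)
  then have "(f ^^ (m mod p + p * (m div p))) x = (f ^^ (m mod p)) x"
    by (simp only: funpow_add comp_apply)
  then show ?thesis by simp
qed

lemma funpow_mod_eq:
  assumes f: "f \<in> free_cyc p A" and x: "x \<in> A"
  shows "(f ^^ m) x = (f ^^ (m mod p)) x"
  using free_cyc_closed[OF f] free_cycD(2)[OF f] x by (rule funpow_mod_on)

lemma free_cyc_funpow_in: "f \<in> free_cyc p A \<Longrightarrow> x \<in> A \<Longrightarrow> (f ^^ m) x \<in> A"
  by (induction m) (auto simp: free_cyc_closed)

lemma free_cyc_fixes_iff:
  assumes f: "f \<in> free_cyc p A" and x: "x \<in> A" and p: "p > 0"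
  shows "(f ^^ m) x = x \<longleftrightarrow> p dvd m"
proof
  assume "(f ^^ m) x = x"
  then show "p dvd m"
    using free_cycD(3)[OF f x, of "m mod p"] funpow_mod_eq[OF f x, of m] p by fastforce
next
  assume "p dvd m"
  then show "(f ^^ m) x = x" using funpow_mod_eq[OF f x, of m] by (simp add: dvd_eq_mod_eq_0)
qed

lemma free_cyc_inj_on:
  assumes f: "f \<in> free_cyc p A" and x: "x \<in> A"
  shows "inj_on (\<lambda>i. (f ^^ i) x) {..<p}"
proof (rule linorder_inj_onI)
  fix i j assume ij: "i < j" "j \<in> {..<p}"
  have "(f ^^ (j - i)) ((f ^^ i) x) = (f ^^ (j - i + i)) x" by (simp only: funpow_add comp_apply)
  then have "(f ^^ (j - i)) ((f ^^ i) x) = (f ^^ j) x" using ij by simp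
  moreover have "0 < j - i" "j - i < p" using ij by auto
  ultimately show "(f ^^ i) x \<noteq> (f ^^ j) x"
    using free_cycD(3)[OF f free_cyc_funpow_in[OF f x, of j], of "j - i"] by metis
qed auto

lemma act_id_right: "act f id w x = (f ^^ count_list w True) x"
  by (induction w arbitrary: x) (simp_all add: funpow_swap1)

lemma orb_free_cyc:
  assumes f: "f \<in> free_cyc p A" and x: "x \<in> A" and p: "p > 0"
  shows "card (orb f id x) = p"
proof -
  have "orb f id x = (\<lambda>i. (f ^^ i) x) ` {..<p}"
  proof (intro equalityI subsetI)
    fix y assume "y \<in> orb f id x"
    then obtain w where "y = (f ^^ (count_list w True mod p)) x"
      using funpow_mod_eq[OF f x] by (auto simp: orb_def act_id_right)
    then show "y \<in> (\<lambda>i. (f ^^ i) x) ` {..<p}" using p by auto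
  next
    fix y assume "y \<in> (\<lambda>i. (f ^^ i) x) ` {..<p}"
    then obtain i where "y = act f id (replicate i True) x" by auto
    then show "y \<in> orb f id x" unfolding orb_def by (rule image_eqI) simp
  qed
  moreover have "inj_on (\<lambda>i. (f ^^ i) x) {..<p}" by (rule free_cyc_inj_on[OF f x])
  ultimately show ?thesis by (simp add: card_image)
qed

text \<open>An orbit of a free action of a cyclic group of order p has p points. For n = p all these
  actions have the same stabiliser, so \<open>card_actions_same_stabiliser\<close> counts them once
  one is exhibited.\<close>

lemma num_transitive_cyclic:
  assumes p: "p > 0" and n: "n > 0"
  shows "num_transitive p (Suc 0) n = (if n = p then fact (p - 1) else 0)"
proof (cases "n = p")
  case False
  have "card {..<n} = p" if "(f, g) \<in> transitive_actions p (Suc 0) {..<n} 0" for f g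
  proof -
    have "f \<in> free_cyc p {..<n}" "g \<in> free_cyc (Suc 0) {..<n}" "orb f g 0 = {..<n}"
      using that by (auto simp: transitive_actions_def free_actions_def)
    moreover have "g = id" using calculation by (simp add: free_cyc_1)
    ultimately show ?thesis using orb_free_cyc[of f p "{..<n}" 0] p n by simp
  qed
  then have "transitive_actions p (Suc 0) {..<n} 0 = {}" using False by auto
  then show ?thesis using False by (simp add: num_transitive_def)
next
  case True
  \<comment> \<open>The rotation of p points serves as the base action for
    \<open>card_actions_same_stabiliser\<close>.\<close>
  define c where "c i = (if i < p then (i + 1) mod p else i)" for i
  have pow: "(c ^^ k) i = (i + k) mod p" if "i < p" for i k
    using that by (induction k) (auto simp: c_def mod_Suc_eq p)
  have "inj_on c {..<p}"
  proof (rule inj_onI)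
    fix i j assume ij: "i \<in> {..<p}" "j \<in> {..<p}" "c i = c j"
    then have "(c ^^ p) i = (c ^^ p) j" using funpow_swap1[of c "p - 1"] p by (cases p) (simp_all add: funpow_swap1)
    then show "i = j" using ij by (simp add: pow)
  qed
  moreover have "c ` {..<p} \<subseteq> {..<p}" using p by (auto simp: c_def)
  ultimately have "bij_betw c {..<p} {..<p}"
    using endo_inj_surj[of "{..<p}" c] by (auto simp: bij_betw_def)
  then have "c permutes {..<p}" by (rule bij_imp_permutes) (simp add: c_def)
  moreover have "(i + k) mod p \<noteq> i" if "i < p" "0 < k" "k < p" for i k
    using that by (cases "i + k < p") (auto simp: mod_if)
  ultimately have c: "c \<in> free_cyc p {..<p}" by (auto simp: free_cyc_def pow)
  have "orb c id 0 = {..<p}"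
  proof (rule card_subset_eq)
    show "orb c id 0 \<subseteq> {..<p}" by (rule orb_subset) (use p free_cyc_closed[OF c] in auto)
    show "card (orb c id 0) = card {..<p}" using orb_free_cyc[OF c _ p] p by simp
  qed simp
  then have tr: "(c, id) \<in> transitive_actions p (Suc 0) {..<p} 0"
    using c by (simp add: transitive_actions_def free_actions_def free_cyc_1)
  \<comment> \<open>Both sides say that p divides the number of letters \<open>True\<close> in
    w.\<close>
  have "act f g w 0 = 0 \<longleftrightarrow> act c id w 0 = 0" if "(f, g) \<in> transitive_actions p (Suc 0) {..<p} 0" for f g w
  proof -
    have f: "f \<in> free_cyc p {..<p}" and "g = id"
      using that by (auto simp: transitive_actions_def free_actions_def free_cyc_1)
    then show ?thesis
      using free_cyc_fixes_iff[OF f _ p, of 0] free_cyc_fixes_iff[OF c _ p, of 0] p by (simp add: act_id_right)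
  qed
  then have "transitive_actions p (Suc 0) {..<p} 0 = {(f, g) \<in> transitive_actions p (Suc 0) {..<p} 0.
      \<forall>w. act f g w 0 = 0 \<longleftrightarrow> act c id w 0 = 0}" by blast
  then have "card (transitive_actions p (Suc 0) {..<p} 0) = fact (card {..<p} - 1)"
    using card_actions_same_stabiliser[OF tr] p by simp
  then show ?thesis using True by (simp add: num_transitive_def)
qed

text \<open>With second order 1 the orbit-splitting recurrence keeps a single term: the orbit of the
  distinguished point has p points, so k = p - 1.\<close>

lemma num_free_Suc:
  assumes p: "p > 0"
  shows "num_free p (Suc n) = (if p \<le> Suc n then (n choose (p - 1)) * fact (p - 1) * num_free p (Suc n - p) else 0)"
proof -
  have "num_free p (Suc n) = (\<Sum>k\<le>n. (n choose k) * (num_transitive p (Suc 0) (Suc k) * num_free p (n - k)))"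
    using num_free_recurrence[of p n "Suc 0"] by (simp add: num_free_1)
  also have "\<dots> = (\<Sum>k\<le>n. if k = p - 1 then (n choose (p - 1)) * fact (p - 1) * num_free p (Suc n - p) else 0)"
    by (intro sum.cong) (use p in \<open>auto simp: num_transitive_cyclic\<close>)
  also have "\<dots> = (if p \<le> Suc n then (n choose (p - 1)) * fact (p - 1) * num_free p (Suc n - p) else 0)"
    using p by (auto simp: sum.delta)
  finally show ?thesis .
qed

lemma num_free_eq_0: "p > 0 \<Longrightarrow> \<not> p dvd n \<Longrightarrow> num_free p n = 0"
proof (induction n rule: less_induct)
  case (less n)
  then obtain m where m: "n = Suc m" by (cases n) auto
  have "\<not> p dvd n - p" if "p \<le> n" using less.prems that by (metis dvd_diffD dvd_refl)
  then have "p \<le> n \<Longrightarrow> num_free p (n - p) = 0" using less m by auto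
  then show ?case using num_free_Suc[of p m] less.prems m by auto
qed

text \<open>The number of permutations consisting of m cycles of length p, freed of division to stay
  in \<open>nat\<close>.\<close>

lemma num_free_mult:
  assumes p: "p > 0"
  shows "num_free p (p * m) * (p ^ m * fact m) = fact (p * m)"
proof (induction m)
  case (Suc m)
  define n where "n = p * Suc m - 1"
  have n: "Suc n = p * Suc m" "p - 1 \<le> n" "n - (p - 1) = p * m" "Suc n - p = p * m"
    using p by (simp_all add: n_def)
  have "num_free p (p * Suc m) * (p ^ Suc m * fact (Suc m)) =
      (n choose (p - 1)) * fact (p - 1) * (num_free p (p * m) * (p ^ m * fact m)) * (p * Suc m)"
    using num_free_Suc[OF p, of n] n by (simp add: algebra_simps)
  also have "\<dots> = fact (p - 1) * fact (n - (p - 1)) * (n choose (p - 1)) * Suc n"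
    unfolding Suc.IH n by (simp add: algebra_simps)
  also have "\<dots> = fact (p * Suc m)"
    unfolding binomial_fact_lemma[OF n(2)] n(1)[symmetric] by (simp only: fact_Suc of_nat_id mult.commute)
  finally show ?case .
qed (simp add: num_free_0)

subsection \<open>Presented monoids\<close>

lemma word_step_equivclp_append:
  assumes "equivclp (word_step R) u u'" "equivclp (word_step R) v v'"
  shows "equivclp (word_step R) (u @ v) (u' @ v')"
proof -
  have step: "word_step R (x @ s @ y) (x @ t @ y)" if st: "word_step R s t" for s t x y
  proof -
    obtain x' y' l r where "(l, r) \<in> R" "s = x' @ l @ y'" "t = x' @ r @ y'"
      using st unfolding word_step_def by blast
    then show ?thesis
      unfolding word_step_def by (intro exI[of _ "x @ x'"] exI[of _ "y' @ y"] exI[of _ l] exI[of _ r]) simp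
  qed
  have "equivclp (word_step R) (u @ v) (u' @ v)"
    using assms(1) by (induction rule: equivclp_induct)
      (use step[of _ _ "[]" v] in \<open>auto intro: equivclp_into_equivclp\<close>)
  moreover have "equivclp (word_step R) (u' @ v) (u' @ v')"
    using assms(2) by (induction rule: equivclp_induct)
      (use step[of _ _ u' "[]"] in \<open>auto intro: equivclp_into_equivclp\<close>)
  ultimately show ?thesis by (rule equivclp_trans)
qed

lemma word_step_equivclp_rel: "(l, r) \<in> R \<Longrightarrow> equivclp (word_step R) (x @ l @ y) (x @ r @ y)"
  by (rule r_into_equivclp) (auto simp: word_step_def)

text \<open>The universal property in working form: letters acting on \<open>D\<close> compatibly
  with the relations give equivalent words the same effect. Homomorphisms out of free groups,
  reduced words and actions of C2*C7 are all handled through it.\<close>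

lemma fold_word_step_equivclp:
  assumes "equivclp (word_step R) u v" "z \<in> D"
    and closed: "\<And>c z. z \<in> D \<Longrightarrow> L c z \<in> D"
    and rel: "\<And>l r z. (l, r) \<in> R \<Longrightarrow> z \<in> D \<Longrightarrow> fold L l z = fold L r z"
  shows "fold L u z = fold L v z"
proof -
  have fold_closed: "fold L w z \<in> D" if "z \<in> D" for w z
    using that by (induction w arbitrary: z) (auto simp: closed)
  have "fold L s z = fold L t z" if "word_step R s t" for s t
    using that rel[OF _ fold_closed[OF assms(2)]] by (auto simp: word_step_def)
  with assms(1) show ?thesis by (induction rule: equivclp_induct) metis+
qed

lemma word_class_eq_iff:
  "u \<in> lists A \<Longrightarrow> v \<in> lists A \<Longrightarrow> word_class A R u = word_class A R v \<longleftrightarrow> equivclp (word_step R) u v"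
proof
  assume "v \<in> lists A" "word_class A R u = word_class A R v"
  then have "v \<in> word_class A R u" by (simp add: word_class_def)
  then show "equivclp (word_step R) u v" by (simp add: word_class_def)
next
  assume *: "equivclp (word_step R) u v"
  have "equivclp (word_step R) u w \<longleftrightarrow> equivclp (word_step R) v w" for w
    using equivclp_trans[OF *] equivclp_trans[OF equivclp_sym[OF *]] by blast
  then show "word_class A R u = word_class A R v" by (simp add: word_class_def)
qed

lemma presented_monoid_carrier: "carrier (presented_monoid A R) = word_class A R ` lists A"
  by (simp add: presented_monoid_def)

lemma presented_monoid_one: "\<one>\<^bsub>presented_monoid A R\<^esub> = word_class A R []"
  by (simp add: presented_monoid_def)

lemma presented_monoid_mult:
  assumes u: "u \<in> lists A" and v: "v \<in> lists A"
  shows "word_class A R u \<otimes>\<^bsub>presented_monoid A R\<^esub> word_class A R v = word_class A R (u @ v)"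
proof -
  have "word_class A R (p @ q) = word_class A R (u @ v)"
    if "p \<in> word_class A R u" "q \<in> word_class A R v" for p q
    using that u v by (subst word_class_eq_iff)
      (auto simp: word_class_def intro: word_step_equivclp_append equivclp_sym)
  moreover have "u \<in> word_class A R u" "v \<in> word_class A R v" using u v by (auto simp: word_class_def)
  ultimately have "(\<Union>p\<in>word_class A R u. \<Union>q\<in>word_class A R v. word_class A R (p @ q)) = word_class A R (u @ v)"
    by blast
  then show ?thesis by (simp add: presented_monoid_def)
qed

text \<open>Left inverses of the letters suffice, since inverse words multiply in reverse order and
  a monoid with left inverses is a group.\<close>

lemma group_presented_monoid:
  assumes inv: "\<And>c. c \<in> A \<Longrightarrow> \<exists>w\<in>lists A. equivclp (word_step R) (w @ [c]) []"
  shows "group (presented_monoid A R)" (is "group ?P")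
proof (rule groupI)
  have "\<exists>v\<in>lists A. equivclp (word_step R) (v @ u) []" if "u \<in> lists A" for u
    using that
  proof (induction u)
    case (Cons c u)
    then obtain v w where v: "v \<in> lists A" "equivclp (word_step R) (v @ u) []"
      and w: "w \<in> lists A" "equivclp (word_step R) (w @ [c]) []" using inv[of c] by auto
    have "equivclp (word_step R) (v @ ((w @ [c]) @ u)) (v @ ([] @ u))"
      by (intro word_step_equivclp_append w) auto
    then have "equivclp (word_step R) ((v @ w) @ c # u) []" using v(2) equivclp_trans by force
    then show ?case using v w by (intro bexI[of _ "v @ w"]) auto
  qed (auto intro: bexI[of _ "[]"])
  then have "\<exists>v\<in>lists A. word_class A R (v @ u) = word_class A R []" if "u \<in> lists A" for u
    using that word_class_eq_iff[of "_ @ u" A "[]" R] by (metis append_in_lists_conv lists.Nil)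
  note left_inv = this
  fix x assume "x \<in> carrier ?P"
  then obtain u where u: "u \<in> lists A" "x = word_class A R u"
    unfolding presented_monoid_carrier by blast
  then obtain v where v: "v \<in> lists A" "word_class A R (v @ u) = word_class A R []"
    using left_inv by blast
  show "\<exists>y\<in>carrier ?P. y \<otimes>\<^bsub>?P\<^esub> x = \<one>\<^bsub>?P\<^esub>"
    by (rule bexI[of _ "word_class A R v"])
      (use u v in \<open>simp_all add: presented_monoid_mult presented_monoid_one presented_monoid_carrier del: in_lists_conv_set\<close>)
next
  fix x y z assume xyz: "x \<in> carrier ?P" "y \<in> carrier ?P" "z \<in> carrier ?P"
  obtain u where u: "u \<in> lists A" "x = word_class A R u"
    using xyz(1) unfolding presented_monoid_carrier by blast
  obtain v where v: "v \<in> lists A" "y = word_class A R v"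
    using xyz(2) unfolding presented_monoid_carrier by blast
  obtain w where w: "w \<in> lists A" "z = word_class A R w"
    using xyz(3) unfolding presented_monoid_carrier by blast
  show "x \<otimes>\<^bsub>?P\<^esub> y \<otimes>\<^bsub>?P\<^esub> z = x \<otimes>\<^bsub>?P\<^esub> (y \<otimes>\<^bsub>?P\<^esub> z)"
    using u(1) v(1) w(1) by (simp add: u(2) v(2) w(2) presented_monoid_mult)
next
  fix x y assume xy: "x \<in> carrier ?P" "y \<in> carrier ?P"
  obtain u where u: "u \<in> lists A" "x = word_class A R u"
    using xy(1) unfolding presented_monoid_carrier by blast
  obtain v where v: "v \<in> lists A" "y = word_class A R v"
    using xy(2) unfolding presented_monoid_carrier by blast
  have "u @ v \<in> lists A" using u(1) v(1) by simp
  then show "x \<otimes>\<^bsub>?P\<^esub> y \<in> carrier ?P"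
    unfolding u(2) v(2) presented_monoid_mult[OF u(1) v(1)] presented_monoid_carrier by (rule imageI)
next
  fix x assume "x \<in> carrier ?P"
  then obtain u where u: "u \<in> lists A" "x = word_class A R u"
    unfolding presented_monoid_carrier by blast
  show "\<one>\<^bsub>?P\<^esub> \<otimes>\<^bsub>?P\<^esub> x = x"
    unfolding u(2) presented_monoid_one by (subst presented_monoid_mult) (use u(1) in simp_all)
qed (auto simp: presented_monoid_carrier presented_monoid_one presented_monoid_mult)

subsection \<open>Free groups\<close>

abbreviation free_group_rels :: "'a set \<Rightarrow> (('a \<times> bool) list \<times> ('a \<times> bool) list) set" where
  "free_group_rels X \<equiv> {([(x, e), (x, \<not> e)], []) | x e. x \<in> X}"

definition free_class :: "'a set \<Rightarrow> ('a \<times> bool) list \<Rightarrow> ('a \<times> bool) list set" where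
  "free_class X w = word_class (X \<times> UNIV) (free_group_rels X) w"

lemma free_group_carrier: "carrier (free_group X) = free_class X ` lists (X \<times> UNIV)"
  by (simp add: free_group_def presented_monoid_carrier free_class_def)

lemma free_group_one: "\<one>\<^bsub>free_group X\<^esub> = free_class X []"
  by (simp add: free_group_def presented_monoid_one free_class_def)

lemma free_group_mult:
  "u \<in> lists (X \<times> UNIV) \<Longrightarrow> v \<in> lists (X \<times> UNIV) \<Longrightarrow>
     free_class X u \<otimes>\<^bsub>free_group X\<^esub> free_class X v = free_class X (u @ v)"
  by (simp add: free_group_def presented_monoid_mult free_class_def)

lemma free_class_eq_iff:
  "u \<in> lists (X \<times> UNIV) \<Longrightarrow> v \<in> lists (X \<times> UNIV) \<Longrightarrow>
     free_class X u = free_class X v \<longleftrightarrow> equivclp (word_step (free_group_rels X)) u v"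
  unfolding free_class_def by (rule word_class_eq_iff)

lemma free_class_cancel:
  assumes "u @ v \<in> lists (X \<times> UNIV)" "x \<in> X"
  shows "free_class X (u @ [(x, e), (x, \<not> e)] @ v) = free_class X (u @ v)"
proof -
  have "equivclp (word_step (free_group_rels X)) (u @ [(x, e), (x, \<not> e)] @ v) (u @ [] @ v)"
    by (rule word_step_equivclp_rel) (use assms in auto)
  then show ?thesis using assms by (subst free_class_eq_iff) auto
qed

lemma group_free_group: "group (free_group X)"
  unfolding free_group_def
proof (rule group_presented_monoid)
  fix c assume "c \<in> X \<times> (UNIV :: bool set)"
  then obtain x e where c: "c = (x, e)" "x \<in> X" by auto
  have "equivclp (word_step (free_group_rels X)) ([] @ [(x, \<not> e), (x, \<not> \<not> e)] @ []) ([] @ [] @ [])"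
    by (rule word_step_equivclp_rel) (use c in blast)
  then show "\<exists>w\<in>lists (X \<times> UNIV). equivclp (word_step (free_group_rels X)) (w @ [c]) []"
    using c by (intro bexI[of _ "[(x, \<not> e)]"]) auto
qed

lemma free_class_inv:
  assumes "x \<in> X"
  shows "inv\<^bsub>free_group X\<^esub> free_class X [(x, e)] = free_class X [(x, \<not> e)]"
proof -
  interpret F: group "free_group X" by (rule group_free_group)
  have "free_class X [(x, \<not> e)] \<otimes>\<^bsub>free_group X\<^esub> free_class X [(x, e)] = \<one>\<^bsub>free_group X\<^esub>"
    using free_class_cancel[of "[]" "[]" X x "\<not> e"] assms
    by (simp add: free_group_mult free_group_one)
  then show ?thesis using assms by (intro F.inv_equality) (auto simp: free_group_carrier)
qed

text \<open>Each letter acts on \<open>K\<close> by right multiplication with its prescribed value;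
  the image of a class is what a representative makes of the unit.\<close>

lemma free_group_hom_exists:
  assumes "group K" and v: "\<And>x. x \<in> X \<Longrightarrow> v x \<in> carrier K"
  obtains h where "h \<in> hom (free_group X) K"
    "\<And>x. x \<in> X \<Longrightarrow> h (free_class X [(x, True)]) = v x"
    "\<And>x. x \<in> X \<Longrightarrow> h (free_class X [(x, False)]) = inv\<^bsub>K\<^esub> v x"
proof -
  interpret K: group K by fact
  \<comment> \<open>Letters outside the alphabet act as the unit, because
    \<open>fold_word_step_equivclp\<close> asks for closure under every letter of the type.\<close>
  define L where "L c z = z \<otimes>\<^bsub>K\<^esub> (if fst c \<in> X then if snd c then v (fst c) else inv\<^bsub>K\<^esub> v (fst c) else \<one>\<^bsub>K\<^esub>)"
    for c z
  have L: "L c z \<in> carrier K" if "z \<in> carrier K" for c z using that by (simp add: L_def v)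
  have fold_closed: "fold L w z \<in> carrier K" if "z \<in> carrier K" for w z
    using that by (induction w arbitrary: z) (auto simp: L)
  have fold_mult: "fold L w z = z \<otimes>\<^bsub>K\<^esub> fold L w \<one>\<^bsub>K\<^esub>" if "z \<in> carrier K" for w z
    using that
  proof (induction w arbitrary: z)
    case (Cons c w)
    have "fold L w (L c z) = L c z \<otimes>\<^bsub>K\<^esub> fold L w \<one>\<^bsub>K\<^esub>" using Cons L by blast
    also have "\<dots> = z \<otimes>\<^bsub>K\<^esub> (L c \<one>\<^bsub>K\<^esub> \<otimes>\<^bsub>K\<^esub> fold L w \<one>\<^bsub>K\<^esub>)"
      using Cons.prems fold_closed by (simp add: L_def v K.m_assoc)
    also have "L c \<one>\<^bsub>K\<^esub> \<otimes>\<^bsub>K\<^esub> fold L w \<one>\<^bsub>K\<^esub> = fold L w (L c \<one>\<^bsub>K\<^esub>)"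
      using Cons.IH[of "L c \<one>\<^bsub>K\<^esub>"] L by simp
    finally show ?case by simp
  qed simp
  have fold_eq: "fold L u \<one>\<^bsub>K\<^esub> = fold L w \<one>\<^bsub>K\<^esub>"
    if "equivclp (word_step (free_group_rels X)) u w" for u w
    using that
  proof (rule fold_word_step_equivclp[where D = "carrier K"])
    fix l r z assume "(l, r) \<in> free_group_rels X" "z \<in> carrier K"
    then show "fold L l z = fold L r z" by (auto simp: L_def v K.m_assoc)
  qed (auto simp: L)
  define h where "h P = fold L (SOME w. w \<in> lists (X \<times> UNIV) \<and> P = free_class X w) \<one>\<^bsub>K\<^esub>" for P
  have h: "h (free_class X w) = fold L w \<one>\<^bsub>K\<^esub>" if w: "w \<in> lists (X \<times> UNIV)" for w
  proof -
    let ?w = "SOME w'. w' \<in> lists (X \<times> UNIV) \<and> free_class X w = free_class X w'"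
    have "?w \<in> lists (X \<times> UNIV) \<and> free_class X w = free_class X ?w" by (rule someI[of _ w]) (use w in simp)
    then have "equivclp (word_step (free_group_rels X)) w ?w" using free_class_eq_iff[OF w] by blast
    then show ?thesis unfolding h_def by (rule fold_eq[symmetric])
  qed
  show thesis
  proof (rule that)
    show "h \<in> hom (free_group X) K"
    proof (rule homI)
      fix P assume "P \<in> carrier (free_group X)"
      then obtain u where "P = free_class X u" "u \<in> lists (X \<times> UNIV)"
        unfolding free_group_carrier by blast
      then show "h P \<in> carrier K" by (simp only: h fold_closed K.one_closed)
    next
      fix P Q assume PQ: "P \<in> carrier (free_group X)" "Q \<in> carrier (free_group X)"
      obtain u where u: "u \<in> lists (X \<times> UNIV)" "P = free_class X u"
        using PQ(1) unfolding free_group_carrier by blast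
      obtain w where w: "w \<in> lists (X \<times> UNIV)" "Q = free_class X w"
        using PQ(2) unfolding free_group_carrier by blast
      show "h (P \<otimes>\<^bsub>free_group X\<^esub> Q) = h P \<otimes>\<^bsub>K\<^esub> h Q"
        using fold_mult[OF fold_closed[OF K.one_closed], of w u] u(1) w(1)
        by (simp add: u(2) w(2) free_group_mult h)
    qed
  qed (simp_all add: h L_def v)
qed

abbreviation noncancelling :: "'a \<times> bool \<Rightarrow> 'a \<times> bool \<Rightarrow> bool" where
  "noncancelling c d \<equiv> \<not> (fst c = fst d \<and> snd c \<noteq> snd d)"

(* The free group acts on reduced words by cancelling or prepending a letter. *)
lemma reduced_word_nontrivial:
  fixes w :: "('a \<times> bool) list"
  assumes w: "successively noncancelling w" and eq: "equivclp (word_step (free_group_rels X)) w []"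
  shows "w = []"
proof -
  define L :: "'a \<times> bool \<Rightarrow> ('a \<times> bool) list \<Rightarrow> ('a \<times> bool) list"
    where "L c st = (if st \<noteq> [] \<and> \<not> noncancelling c (hd st) then tl st else c # st)" for c st
  have L: "successively noncancelling (L c st)" if "successively noncancelling st" for c st
    using that by (cases st; cases "tl st") (auto simp: L_def successively_Cons)
  have "fold L w [] = fold L [] []"
    using eq
  proof (rule fold_word_step_equivclp[where D = "{st. successively noncancelling st}"])
    fix l r and st :: "('a \<times> bool) list"
    assume "(l, r) \<in> free_group_rels X" "st \<in> {st. successively noncancelling st}"
    then show "fold L l st = fold L r st"
      by (cases st; cases "tl st") (auto simp: L_def successively_Cons)
  next
    fix c and st :: "('a \<times> bool) list" assume "st \<in> {st. successively noncancelling st}"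
    then show "L c st \<in> {st. successively noncancelling st}" using L by blast
  qed simp
  \<comment> \<open>On a reduced word no cancellation happens: the letters pile up in reverse
    order.\<close>
  moreover have "fold L u st = rev u @ st" if "successively noncancelling (rev u @ st)" for u st
    using that
  proof (induction u arbitrary: st)
    case (Cons c u)
    then have "successively noncancelling (c # st)" by (simp add: successively_append_iff)
    then have "L c st = c # st" by (cases st) (auto simp: L_def)
    then show ?case using Cons by simp
  qed simp
  moreover have "successively noncancelling (rev w @ [])"
    using successively_mono[OF w, of "\<lambda>c d. noncancelling d c"] by (auto simp: successively_rev)
  ultimately show ?thesis by simp
qed

lemma not_successivelyD:
  "\<not> successively P w \<Longrightarrow> \<exists>u c d v. w = u @ [c, d] @ v \<and> \<not> P c d"
proof (induction w)
  case (Cons c w)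
  then show ?case
  proof (cases "successively P w")
    case True
    then have "w \<noteq> []" "\<not> P c (hd w)" using Cons.prems by (auto simp: successively_Cons)
    then show ?thesis by (metis append_Cons append_Nil list.collapse)
  next
    case False
    then show ?thesis using Cons.IH by (metis append_Cons)
  qed
qed simp

lemma (in group) inv_mult_cancel:
  assumes "x \<in> carrier G" "y \<in> carrier G"
  shows "inv x \<otimes> (x \<otimes> y) = y" "x \<otimes> (inv x \<otimes> y) = y"
  using assms by (simp_all flip: m_assoc)

lemma (in group) conjugate_pow:
  assumes "g \<in> carrier G" "x \<in> carrier G"
  shows "(g \<otimes> x \<otimes> inv g) [^] (n::nat) = g \<otimes> x [^] n \<otimes> inv g"
proof (induction n)
  case (Suc n)
  have "g \<otimes> x [^] n \<otimes> inv g \<otimes> (g \<otimes> x \<otimes> inv g) = g \<otimes> (x [^] n \<otimes> x) \<otimes> inv g"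
    using assms by (simp add: m_assoc inv_mult_cancel)
  then show ?case using Suc by simp
qed (use assms in simp)

(* A shortest word representing a conjugate is cyclically reduced, hence all its powers are reduced. *)
lemma free_group_torsion_free:
  assumes f: "f \<in> carrier (free_group X)" and p: "p > 0"
    and tor: "f [^]\<^bsub>free_group X\<^esub> (p::nat) = \<one>\<^bsub>free_group X\<^esub>"
  shows "f = \<one>\<^bsub>free_group X\<^esub>"
proof -
  let ?F = "free_group X"
  interpret F: group ?F by (rule group_free_group)
  define C where "C w \<longleftrightarrow> w \<in> lists (X \<times> UNIV) \<and>
    (\<exists>g\<in>carrier ?F. free_class X w = g \<otimes>\<^bsub>?F\<^esub> f \<otimes>\<^bsub>?F\<^esub> inv\<^bsub>?F\<^esub> g)" for w
  obtain w0 where "w0 \<in> lists (X \<times> UNIV)" "f = free_class X w0" using f by (auto simp: free_group_carrier)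
  then have "C w0" unfolding C_def using f by (auto intro!: bexI[of _ "\<one>\<^bsub>?F\<^esub>"])
  then obtain w where w: "C w" and minimal: "\<And>w'. C w' \<Longrightarrow> length w \<le> length w'"
    using ex_has_least_nat[of C w0 length] by blast
  obtain g where wl: "w \<in> lists (X \<times> UNIV)" and g: "g \<in> carrier ?F"
    "free_class X w = g \<otimes>\<^bsub>?F\<^esub> f \<otimes>\<^bsub>?F\<^esub> inv\<^bsub>?F\<^esub> g" using w by (auto simp: C_def)
  have pow: "free_class X w [^]\<^bsub>?F\<^esub> n = free_class X (concat (replicate n w))
      \<and> concat (replicate n w) \<in> lists (X \<times> UNIV)" for n :: nat
  proof (induction n)
    case (Suc n)
    have "concat (replicate (Suc n) w) = concat (replicate n w) @ w"
      by (simp flip: replicate_append_same)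
    then show ?case using Suc wl free_group_mult[of "concat (replicate n w)" X w] by auto
  qed (simp add: free_group_one)
  have "free_class X w [^]\<^bsub>?F\<^esub> p = \<one>\<^bsub>?F\<^esub>"
    unfolding g(2) using F.conjugate_pow[OF g(1) f, of p] g(1) tor by simp
  then have triv: "equivclp (word_step (free_group_rels X)) (concat (replicate p w)) []"
    using pow[of p] by (simp add: free_group_one free_class_eq_iff)
  have red: "successively noncancelling w"
  proof (rule ccontr)
    assume "\<not> ?thesis"
    then obtain u c d v where uv: "w = u @ [c, d] @ v" "\<not> noncancelling c d" using not_successivelyD by blast
    obtain x e where c: "c = (x, e)" "d = (x, \<not> e)" using uv by (cases c, cases d) auto
    have "free_class X (u @ v) = free_class X w"
      using free_class_cancel[of u v X x e] wl uv c by auto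
    then have "C (u @ v)" using w wl uv by (auto simp: C_def)
    then show False using minimal[of "u @ v"] uv by simp
  qed
  have cyc: "noncancelling (last w) (hd w)" if ne: "w \<noteq> []"
  proof (rule ccontr)
    assume c: "\<not> noncancelling (last w) (hd w)"
    obtain x e where h: "hd w = (x, e)" by (cases "hd w")
    have l: "last w = (x, \<not> e)" using c h by (cases "last w") auto
    obtain w' where w': "w = (x, e) # w'" using ne h by (cases w) auto
    have ne': "w' \<noteq> []" using l w' by auto
    obtain u where u: "w' = u @ [(x, \<not> e)]" using l ne' w' by (metis append_butlast_last_id last_ConsR)
    have x: "x \<in> X" and ul: "u \<in> lists (X \<times> UNIV)" using wl w' u by auto
    \<comment> \<open>Conjugating by the inverse of the first letter strips both ends of w and
      leaves the shorter \<open>u\<close>, against minimality.\<close>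
    let ?k = "free_class X [(x, \<not> e)]"
    have k: "?k \<in> carrier ?F" "inv\<^bsub>?F\<^esub> ?k = free_class X [(x, e)]"
      using x free_class_inv[OF x, of "\<not> e"] by (auto simp: free_group_carrier)
    have "free_class X u = free_class X ([] @ [(x, \<not> e), (x, \<not> \<not> e)] @ (u @ []))"
      using free_class_cancel[of "[]" u X x "\<not> e"] ul x by simp
    also have "\<dots> = free_class X (([(x, \<not> e), (x, e)] @ u) @ [(x, \<not> e), (x, \<not> \<not> e)] @ [])"
      using free_class_cancel[of "[(x, \<not> e), (x, e)] @ u" "[]" X x "\<not> e"] ul x by simp
    also have "\<dots> = ?k \<otimes>\<^bsub>?F\<^esub> free_class X w \<otimes>\<^bsub>?F\<^esub> inv\<^bsub>?F\<^esub> ?k"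
      using wl x ul by (simp add: k free_group_mult w' u)
    also have "\<dots> = (?k \<otimes>\<^bsub>?F\<^esub> g) \<otimes>\<^bsub>?F\<^esub> f \<otimes>\<^bsub>?F\<^esub> inv\<^bsub>?F\<^esub> (?k \<otimes>\<^bsub>?F\<^esub> g)"
      unfolding g(2) using k(1) g(1) f by (simp add: F.inv_mult_group F.m_assoc)
    finally have "C u" unfolding C_def using k(1) g(1) ul by auto
    then show False using minimal[of u] w' u by simp
  qed
  have "successively noncancelling (concat (replicate n w))" for n
  proof (induction n)
    case (Suc n)
    show ?case
    proof (cases "w = []")
      case False
      have "concat (replicate n w) = [] \<or> hd (concat (replicate n w)) = hd w"
        using False by (cases n) auto
      then show ?thesis using Suc red cyc[OF False] by (auto simp: successively_append_iff)
    qed simp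
  qed simp
  then have "concat (replicate p w) = []" using reduced_word_nontrivial triv by blast
  then have "w = []" using p by (cases p) auto
  then have "g \<otimes>\<^bsub>?F\<^esub> f \<otimes>\<^bsub>?F\<^esub> inv\<^bsub>?F\<^esub> g = \<one>\<^bsub>?F\<^esub>" using g(2) by (simp add: free_group_one)
  then have "inv\<^bsub>?F\<^esub> g \<otimes>\<^bsub>?F\<^esub> (g \<otimes>\<^bsub>?F\<^esub> f \<otimes>\<^bsub>?F\<^esub> inv\<^bsub>?F\<^esub> g) \<otimes>\<^bsub>?F\<^esub> g = \<one>\<^bsub>?F\<^esub>"
    using g(1) by simp
  then show ?thesis using g(1) f by (simp add: F.m_assoc F.inv_mult_cancel)
qed

subsection \<open>The group \<open>C\<^sub>2 * C\<^sub>7\<close>\<close>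

abbreviation hecke_letters :: "(int + int) set" where
  "hecke_letters \<equiv> carrier (integer_mod_group 2) <+> carrier (integer_mod_group 7)"

abbreviation hecke_rels :: "((int + int) list \<times> (int + int) list) set" where
  "hecke_rels \<equiv> free_product_rels (integer_mod_group 2) (integer_mod_group 7)"

definition gen_letter :: "bool \<Rightarrow> int + int" where
  "gen_letter c = (if c then Inl 1 else Inr 1)"

definition gen_order :: "bool \<Rightarrow> nat" where
  "gen_order c = (if c then 2 else 7)"

lemma gen_order_pos [simp]: "gen_order c > 0"
  by (simp add: gen_order_def)

text \<open>Reduces the alphabet of all residues, zeros included, to the two generators. Every
  element is still of this form because the letter k is the k-th power of its generator.\<close>

definition ev :: "bool list \<Rightarrow> (int + int) list set" where
  "ev w = word_class hecke_letters hecke_rels (map gen_letter w)"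

abbreviation H7 :: "(int + int) list set monoid" where "H7 \<equiv> hecke_group_7"

lemma hecke_group_7_eq: "H7 = presented_monoid hecke_letters hecke_rels"
  by (simp add: hecke_group_7_def free_product_def)

lemma carrier_mod: "carrier (integer_mod_group 2) = {0..<2}" "carrier (integer_mod_group 7) = {0..<7}"
  by (simp_all add: carrier_integer_mod_group)

lemma gen_letters: "map gen_letter w \<in> lists hecke_letters"
  by (induction w) (auto simp: gen_letter_def carrier_mod)

lemma ev_eq_iff:
  "ev u = ev v \<longleftrightarrow> equivclp (word_step hecke_rels) (map gen_letter u) (map gen_letter v)"
  unfolding ev_def by (rule word_class_eq_iff[OF gen_letters gen_letters])

lemma ev_append: "ev (u @ v) = ev u \<otimes>\<^bsub>H7\<^esub> ev v"
  unfolding ev_def hecke_group_7_eq presented_monoid_mult[OF gen_letters gen_letters] by simp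

lemma ev_Nil: "ev [] = \<one>\<^bsub>H7\<^esub>"
  by (simp add: ev_def hecke_group_7_eq presented_monoid_one)

lemma ev_in_carrier: "ev w \<in> carrier H7"
  unfolding ev_def hecke_group_7_eq presented_monoid_carrier using gen_letters by (rule imageI)

lemma hecke_rels_intros:
  "([Inl 0], []) \<in> hecke_rels" "([Inr 0], []) \<in> hecke_rels"
  "a \<in> {0..<2} \<Longrightarrow> b \<in> {0..<2} \<Longrightarrow> ([Inl a, Inl b], [Inl ((a + b) mod 2)]) \<in> hecke_rels"
  "a \<in> {0..<7} \<Longrightarrow> b \<in> {0..<7} \<Longrightarrow> ([Inr a, Inr b], [Inr ((a + b) mod 7)]) \<in> hecke_rels"
  by (auto simp: free_product_rels_def carrier_mod)

lemma replicate_gen_letter: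
  "n < 2 \<Longrightarrow> equivclp (word_step hecke_rels) (map gen_letter (replicate n True)) [Inl (int n)]"
  "n < 7 \<Longrightarrow> equivclp (word_step hecke_rels) (map gen_letter (replicate n False)) [Inr (int n)]"
proof (induction n)
  case 0
  { case 1 show ?case using word_step_equivclp_rel[OF hecke_rels_intros(1), of "[]" "[]"]
      by (auto intro: equivclp_sym) }
  { case 2 show ?case using word_step_equivclp_rel[OF hecke_rels_intros(2), of "[]" "[]"]
      by (auto intro: equivclp_sym) }
next
  case (Suc n)
  { case 1
    then have "equivclp (word_step hecke_rels) ([Inl 1] @ map gen_letter (replicate n True)) ([Inl 1] @ [Inl (int n)])"
      using Suc.IH(1) by (intro word_step_equivclp_append) auto
    also have "equivclp (word_step hecke_rels) ([Inl 1] @ [Inl (int n)]) [Inl (int (Suc n))]"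
      using word_step_equivclp_rel[OF hecke_rels_intros(3)[of 1 "int n"], of "[]" "[]"] 1 by simp
    finally show ?case by (simp add: gen_letter_def) }
  { case 2
    then have "equivclp (word_step hecke_rels) ([Inr 1] @ map gen_letter (replicate n False)) ([Inr 1] @ [Inr (int n)])"
      using Suc.IH(2) by (intro word_step_equivclp_append) auto
    also have "equivclp (word_step hecke_rels) ([Inr 1] @ [Inr (int n)]) [Inr (int (Suc n))]"
      using word_step_equivclp_rel[OF hecke_rels_intros(4)[of 1 "int n"], of "[]" "[]"] 2 by simp
    finally show ?case by (simp add: gen_letter_def) }
qed

lemma ev_order: "ev (replicate 2 True) = \<one>\<^bsub>H7\<^esub>" "ev (replicate 7 False) = \<one>\<^bsub>H7\<^esub>"
proof -
  have "equivclp (word_step hecke_rels) ([Inl 1] @ [Inl 1]) ([] @ [Inl 0] @ [])"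
    using word_step_equivclp_rel[OF hecke_rels_intros(3)[of 1 1], of "[]" "[]"] by simp
  also have "equivclp (word_step hecke_rels) ([] @ [Inl 0] @ []) ([] @ [] @ [])"
    by (rule word_step_equivclp_rel[OF hecke_rels_intros(1)])
  finally show "ev (replicate 2 True) = \<one>\<^bsub>H7\<^esub>"
    unfolding ev_Nil[symmetric] ev_eq_iff by (simp add: gen_letter_def numeral_2_eq_2)
  have "equivclp (word_step hecke_rels) ([Inr 1] @ map gen_letter (replicate 6 False)) ([Inr 1] @ [Inr (int 6)])"
    by (intro word_step_equivclp_append replicate_gen_letter) auto
  also have "equivclp (word_step hecke_rels) ([Inr 1] @ [Inr (int 6)]) ([] @ [Inr 0] @ [])"
    using word_step_equivclp_rel[OF hecke_rels_intros(4)[of 1 6], of "[]" "[]"] by simp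
  also have "equivclp (word_step hecke_rels) ([] @ [Inr 0] @ []) ([] @ [] @ [])"
    by (rule word_step_equivclp_rel[OF hecke_rels_intros(2)])
  finally have "equivclp (word_step hecke_rels) (map gen_letter (False # replicate 6 False)) []"
    by (simp add: gen_letter_def)
  moreover have "replicate 7 False = False # replicate 6 False" by (simp add: numeral_eq_Suc)
  ultimately show "ev (replicate 7 False) = \<one>\<^bsub>H7\<^esub>"
    unfolding ev_Nil[symmetric] ev_eq_iff by simp
qed

lemma ev_gen_order: "ev (replicate (gen_order c) c) = \<one>\<^bsub>H7\<^esub>"
  unfolding gen_order_def using ev_order by (cases c) (simp_all only: if_True if_False)

lemma ev_surj: assumes "x \<in> carrier H7" obtains w where "x = ev w"
proof -
  obtain u where u: "u \<in> lists hecke_letters" "x = word_class hecke_letters hecke_rels u"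
    using assms unfolding hecke_group_7_eq presented_monoid_carrier by blast
  have "\<exists>w. equivclp (word_step hecke_rels) (map gen_letter w) u"
    using u(1)
  proof (induction u)
    case Nil
    show ?case by (rule exI[of _ "[]"]) simp
  next
    case (Cons c u)
    then obtain w where w: "equivclp (word_step hecke_rels) (map gen_letter w) u" by auto
    have "\<exists>v. equivclp (word_step hecke_rels) (map gen_letter v) [c]"
    proof (cases c)
      case (Inl k)
      then have "0 \<le> k" "nat k < 2" using Cons.hyps by (auto simp: carrier_mod)
      then show ?thesis using replicate_gen_letter(1)[of "nat k"] Inl
        by (intro exI[of _ "replicate (nat k) True"]) simp
    next
      case (Inr k)
      then have "0 \<le> k" "nat k < 7" using Cons.hyps by (auto simp: carrier_mod)
      then show ?thesis using replicate_gen_letter(2)[of "nat k"] Inr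
        by (intro exI[of _ "replicate (nat k) False"]) simp
    qed
    then obtain v where v: "equivclp (word_step hecke_rels) (map gen_letter v) [c]" by blast
    show ?case using word_step_equivclp_append[OF v w] by (intro exI[of _ "v @ w"]) simp
  qed
  then obtain w where w: "equivclp (word_step hecke_rels) (map gen_letter w) u" by blast
  have "ev w = x" unfolding ev_def u(2) word_class_eq_iff[OF gen_letters u(1)] by (rule w)
  then show thesis by (rule that[OF sym])
qed

lemma group_hecke: "group H7"
  unfolding hecke_group_7_eq
proof (rule group_presented_monoid)
  fix c assume c: "c \<in> hecke_letters"
  show "\<exists>w\<in>lists hecke_letters. equivclp (word_step hecke_rels) (w @ [c]) []"
  proof (cases c)
    case (Inl k)
    then have k: "0 \<le> k" "k < 2" using c by (auto simp: carrier_mod)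
    define k' where "k' = (- k) mod 2"
    have k': "k' \<in> {0..<2}" "(k' + k) mod 2 = 0" by (simp_all add: k'_def mod_simps)
    have "equivclp (word_step hecke_rels) ([Inl k'] @ [Inl k]) ([] @ [Inl 0] @ [])"
      using word_step_equivclp_rel[OF hecke_rels_intros(3)[of k' k], of "[]" "[]"] k k' by simp
    also have "equivclp (word_step hecke_rels) ([] @ [Inl 0] @ []) ([] @ [] @ [])"
      by (rule word_step_equivclp_rel[OF hecke_rels_intros(1)])
    finally show ?thesis using Inl k' by (intro bexI[of _ "[Inl k']"]) (auto simp: carrier_mod)
  next
    case (Inr k)
    then have k: "0 \<le> k" "k < 7" using c by (auto simp: carrier_mod)
    define k' where "k' = (- k) mod 7"
    have k': "k' \<in> {0..<7}" "(k' + k) mod 7 = 0" by (simp_all add: k'_def mod_simps)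
    have "equivclp (word_step hecke_rels) ([Inr k'] @ [Inr k]) ([] @ [Inr 0] @ [])"
      using word_step_equivclp_rel[OF hecke_rels_intros(4)[of k' k], of "[]" "[]"] k k' by simp
    also have "equivclp (word_step hecke_rels) ([] @ [Inr 0] @ []) ([] @ [] @ [])"
      by (rule word_step_equivclp_rel[OF hecke_rels_intros(2)])
    finally show ?thesis using Inr k' by (intro bexI[of _ "[Inr k']"]) (auto simp: carrier_mod)
  qed
qed

text \<open>Universal property of C2*C7: maps of order 2 and 7 on \<open>D\<close> define an action
  of the group, so the effect of a word depends only on its value under \<open>ev\<close>.\<close>

lemma act_eq_of_ev_eq:
  assumes D: "\<And>y. y \<in> D \<Longrightarrow> f y \<in> D" "\<And>y. y \<in> D \<Longrightarrow> g y \<in> D"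
    and "\<And>y. y \<in> D \<Longrightarrow> (f ^^ 2) y = y" "\<And>y. y \<in> D \<Longrightarrow> (g ^^ 7) y = y"
    and x: "x \<in> D" and eq: "ev u = ev v"
  shows "act f g u x = act f g v x"
proof -
  \<comment> \<open>The action on the full alphabet: the letter k acts as the k-th power of its
    generator. Negative letters, which occur in no relation, act trivially.\<close>
  define L where "L = case_sum (\<lambda>k. f ^^ nat k) (\<lambda>k. g ^^ nat k)"
  have fD: "(f ^^ n) y \<in> D" and gD: "(g ^^ n) y \<in> D" if "y \<in> D" for n y
    using that D by (induction n) auto
  have act: "act f g w y = fold L (map gen_letter w) y" for w y
    by (induction w arbitrary: y) (auto simp: L_def gen_letter_def)
  have "fold L (map gen_letter u) x = fold L (map gen_letter v) x"
    using eq[unfolded ev_eq_iff] x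
  proof (rule fold_word_step_equivclp)
    fix c y assume "y \<in> D"
    then show "L c y \<in> D" by (cases c) (simp_all add: L_def fD gD)
  next
    fix l r y assume lr: "(l, r) \<in> hecke_rels" and y: "y \<in> D"
    have add: "(h ^^ nat j) ((h ^^ nat i) y) = (h ^^ nat ((i + j) mod int p)) y"
      if "\<And>y. y \<in> D \<Longrightarrow> h y \<in> D" "\<And>y. y \<in> D \<Longrightarrow> (h ^^ p) y = y" "0 \<le> i" "0 \<le> j" for h p i j
    proof -
      have "nat ((i + j) mod int p) = (nat j + nat i) mod p"
        using that(3,4) by (simp add: nat_mod_distrib nat_add_distrib add.commute)
      then show ?thesis using funpow_mod_on[of D h p y "nat j + nat i"] that(1,2) y by (simp add: funpow_add)
    qed
    show "fold L l y = fold L r y"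
      using lr add[of f 2] add[of g 7] assms(1-4)
      by (auto simp: free_product_rels_def carrier_mod mult_integer_mod_group L_def)
  qed
  then show ?thesis by (simp add: act)
qed

interpretation H: group H7 by (rule group_hecke)

lemma ev_winv: "ev (winv 2 7 w) = inv\<^bsub>H7\<^esub> ev w"
proof (induction w)
  case (Cons c w)
  have "replicate (gen_order c - 1) c @ [c] = replicate (gen_order c) c"
    by (simp add: replicate_append_same flip: replicate_Suc)
  then have "ev (replicate (gen_order c - 1) c) \<otimes>\<^bsub>H7\<^esub> ev [c] = \<one>\<^bsub>H7\<^esub>"
    by (simp only: ev_gen_order flip: ev_append)
  then have "inv\<^bsub>H7\<^esub> ev [c] = ev (replicate (gen_order c - 1) c)"
    by (rule H.inv_equality) (simp_all add: ev_in_carrier)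
  moreover have "ev (c # w) = ev [c] \<otimes>\<^bsub>H7\<^esub> ev w" by (simp flip: ev_append)
  ultimately show ?case
    using Cons by (simp add: ev_append H.inv_mult_group ev_in_carrier gen_order_def)
qed (simp add: ev_Nil)

lemma ev_replicate_pow: "ev (replicate n c) = ev [c] [^]\<^bsub>H7\<^esub> n"
proof (induction n)
  case (Suc n)
  have "ev (replicate (Suc n) c) = ev (replicate n c @ [c])" by (simp flip: replicate_append_same)
  then show ?case using Suc by (simp add: ev_append)
qed (simp add: ev_Nil)

lemma ev_replicate_mod: "ev (replicate n c) = ev (replicate (n mod gen_order c) c)"
proof -
  let ?r = "gen_order c"
  have "ev [c] [^]\<^bsub>H7\<^esub> n = ev [c] [^]\<^bsub>H7\<^esub> (?r * (n div ?r) + n mod ?r)" by simp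
  also have "\<dots> = (ev [c] [^]\<^bsub>H7\<^esub> ?r) [^]\<^bsub>H7\<^esub> (n div ?r) \<otimes>\<^bsub>H7\<^esub> ev [c] [^]\<^bsub>H7\<^esub> (n mod ?r)"
    by (simp only: H.nat_pow_pow H.nat_pow_mult ev_in_carrier)
  also have "\<dots> = ev [c] [^]\<^bsub>H7\<^esub> (n mod ?r)"
    using ev_gen_order[of c] by (simp add: ev_replicate_pow ev_in_carrier)
  finally show ?thesis by (simp add: ev_replicate_pow)
qed

section \<open>From transitive actions to subgroups of finite index\<close>

locale hecke_action =
  fixes f g :: "nat \<Rightarrow> nat" and N :: nat
  assumes transitive: "(f, g) \<in> transitive_actions 2 7 {..<N} 0" and N_pos: "0 < N"
begin

lemma free: "(f, g) \<in> free_actions 2 7 {..<N}" and orbit: "orb f g 0 = {..<N}"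
  using transitive by (auto simp: transitive_actions_def)

lemmas f_closed = free_actionsD(3)[OF free]
  and g_closed = free_actionsD(4)[OF free]
  and f_order = free_actionsD(5)[OF free]
  and g_order = free_actionsD(6)[OF free]

lemma zero_in: "0 \<in> {..<N}" using N_pos by simp

lemma act_in: "y \<in> {..<N} \<Longrightarrow> act f g w y \<in> {..<N}"
  using f_closed g_closed by (rule act_closed)

lemma act_cong_ev: "ev u = ev v \<Longrightarrow> y \<in> {..<N} \<Longrightarrow> act f g u y = act f g v y"
  by (rule act_eq_of_ev_eq[OF f_closed g_closed f_order g_order])

lemma reach: assumes "y \<in> {..<N}" obtains w where "act f g w 0 = y"
  using assms unfolding orbit[symmetric] orb_def by blast

lemma act_winv_ev: "y \<in> {..<N} \<Longrightarrow> act f g (winv 2 7 w) (act f g w y) = y"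
  by (rule act_winv[OF f_closed g_closed _ f_order g_order]) auto

definition stab :: "(int + int) list set set" where
  "stab = {ev w | w. act f g w 0 = 0}"

lemma ev_in_stab_iff: "ev w \<in> stab \<longleftrightarrow> act f g w 0 = 0"
proof
  assume "ev w \<in> stab"
  then obtain v where v: "ev w = ev v" "act f g v 0 = 0" unfolding stab_def by blast
  show "act f g w 0 = 0" using act_cong_ev[OF v(1) zero_in] v(2) by simp
qed (auto simp: stab_def)

lemma stab_subset: "stab \<subseteq> carrier H7"
  by (auto simp: stab_def ev_in_carrier)

lemma subgroup_stab: "subgroup stab H7"
proof (rule H.subgroupI[OF stab_subset])
  show "stab \<noteq> {}" using ev_in_stab_iff[of "[]"] by auto
  fix x assume "x \<in> stab"
  then obtain w where w: "x = ev w" "act f g w 0 = 0" by (auto simp: stab_def)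
  have "act f g (winv 2 7 w) 0 = 0" using act_winv_ev[OF zero_in, of w] w(2) by simp
  then show "inv\<^bsub>H7\<^esub> x \<in> stab" by (simp add: w(1) ev_in_stab_iff flip: ev_winv)
  fix y assume "y \<in> stab"
  then obtain v where v: "y = ev v" "act f g v 0 = 0" by (auto simp: stab_def)
  show "x \<otimes>\<^bsub>H7\<^esub> y \<in> stab" using w v by (simp add: ev_in_stab_iff flip: ev_append)
qed

text \<open>Since words act on the right, a right coset of the stabiliser collects the elements
  carrying 0 to one given point; cosets and points thus correspond.\<close>

lemma stab_coset: "stab #>\<^bsub>H7\<^esub> ev u = {ev w | w. act f g w 0 = act f g u 0}"
proof (intro equalityI subsetI)
  fix x assume "x \<in> stab #>\<^bsub>H7\<^esub> ev u"
  then obtain v where "act f g v 0 = 0" "x = ev (v @ u)" by (auto simp: r_coset_def stab_def ev_append)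
  then show "x \<in> {ev w | w. act f g w 0 = act f g u 0}" by (intro CollectI exI[of _ "v @ u"]) simp
next
  fix x assume "x \<in> {ev w | w. act f g w 0 = act f g u 0}"
  then obtain w where w: "x = ev w" "act f g w 0 = act f g u 0" by auto
  have "ev (w @ winv 2 7 u) \<in> stab"
    by (simp add: ev_in_stab_iff w(2) act_winv_ev[OF zero_in])
  moreover have "x = ev (w @ winv 2 7 u) \<otimes>\<^bsub>H7\<^esub> ev u"
    by (simp add: w(1) ev_append ev_winv H.m_assoc ev_in_carrier)
  ultimately show "x \<in> stab #>\<^bsub>H7\<^esub> ev u" by (auto simp: r_coset_def)
qed

lemma card_rcosets_stab: "card (rcosets\<^bsub>H7\<^esub> stab) = N"
proof -
  define C where "C y = {ev w | w. act f g w 0 = y}" for y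
  have "bij_betw C {..<N} (rcosets\<^bsub>H7\<^esub> stab)"
  proof (rule bij_betw_imageI)
    show "inj_on C {..<N}"
    proof (rule inj_onI)
      fix y z assume yz: "y \<in> {..<N}" "z \<in> {..<N}" "C y = C z"
      obtain w where w: "act f g w 0 = y" using reach[OF yz(1)] .
      then have "ev w \<in> C z" using yz(3) by (auto simp: C_def)
      then obtain v where "ev w = ev v" "act f g v 0 = z" by (auto simp: C_def)
      then show "y = z" using act_cong_ev[OF _ zero_in] w by metis
    qed
    show "C ` {..<N} = rcosets\<^bsub>H7\<^esub> stab"
    proof (intro equalityI subsetI)
      fix P assume "P \<in> C ` {..<N}"
      then obtain y where y: "y \<in> {..<N}" "P = C y" by auto
      obtain w where "act f g w 0 = y" using reach[OF y(1)] .
      then have "P = stab #>\<^bsub>H7\<^esub> ev w" by (simp add: y(2) C_def stab_coset)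
      then show "P \<in> rcosets\<^bsub>H7\<^esub> stab" using H.rcosetsI[OF stab_subset ev_in_carrier] by simp
    next
      fix P assume "P \<in> rcosets\<^bsub>H7\<^esub> stab"
      then obtain x where x: "x \<in> carrier H7" "P = stab #>\<^bsub>H7\<^esub> x" by (auto simp: RCOSETS_def)
      obtain w where "x = ev w" using ev_surj[OF x(1)] .
      then have "P = C (act f g w 0)" by (simp add: x(2) C_def stab_coset)
      then show "P \<in> C ` {..<N}" using act_in[OF zero_in] by auto
    qed
  qed
  then show ?thesis using bij_betw_same_card by fastforce
qed

end

section \<open>From free subgroups to free actions on cosets\<close>

lemma is_free_group_torsion_free:
  assumes free: "is_free_group G" and x: "x \<in> carrier G" and p: "p > 0"
    and tor: "x [^]\<^bsub>G\<^esub> (p::nat) = \<one>\<^bsub>G\<^esub>"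
  shows "x = \<one>\<^bsub>G\<^esub>"
proof -
  obtain X :: "'a set" where G: "group G" and "G \<cong> free_group X"
    using free by (auto simp: is_free_group_def)
  then obtain h where h: "h \<in> hom G (free_group X)" "bij_betw h (carrier G) (carrier (free_group X))"
    by (auto simp: is_iso_def iso_def)
  interpret h: group_hom G "free_group X" h
    by (rule group_hom.intro[OF G group_free_group]) (simp add: group_hom_axioms_def h(1))
  have "h x [^]\<^bsub>free_group X\<^esub> p = \<one>\<^bsub>free_group X\<^esub>"
    using x tor by (simp flip: h.hom_nat_pow)
  then have "h x = h \<one>\<^bsub>G\<^esub>" using free_group_torsion_free[of "h x" X p] x p by simp
  then show ?thesis using h(2) x by (auto simp: bij_betw_def inj_on_def)
qed

text \<open>The count (p - 1)! is not zero.\<close>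

lemma free_cyc_nonempty:
  assumes p: "p > 0" obtains c where "c \<in> free_cyc p {..<p}"
proof -
  have "transitive_actions p (Suc 0) {..<p} (0::nat) \<noteq> {}"
    using num_transitive_cyclic[OF p p] by (auto simp: num_transitive_def)
  then show thesis using that by (auto simp: transitive_actions_def free_actions_def)
qed

text \<open>Seen in an action: one generator becomes a cycle of its full order, the other the
  identity.\<close>

lemma ev_power_nontrivial:
  assumes "0 < i" "i < gen_order c"
  shows "ev (replicate i c) \<noteq> \<one>\<^bsub>H7\<^esub>"
proof
  assume eq: "ev (replicate i c) = \<one>\<^bsub>H7\<^esub>"
  obtain r where r: "r \<in> free_cyc (gen_order c) {..<gen_order c}"
    using free_cyc_nonempty[OF gen_order_pos] .
  define h where "h d = (if c = d then r else id)" for d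
  have h: "(h d ^^ gen_order d) y = y" "h d y \<in> {..<gen_order c}" if "y \<in> {..<gen_order c}" for d y
    using that free_cyc_closed[OF r] free_cycD(2)[OF r] by (auto simp: h_def)
  have "act (h True) (h False) (replicate i c) 0 = act (h True) (h False) [] 0"
  proof (rule act_eq_of_ev_eq)
    show "ev (replicate i c) = ev []" using eq by (simp add: ev_Nil)
    show "(h True ^^ 2) y = y" "(h False ^^ 7) y = y" if "y \<in> {..<gen_order c}" for y
      using h(1)[OF that, of True] h(1)[OF that, of False] by (simp_all only: gen_order_def if_True if_False)
  qed (use h in auto)
  then have "(r ^^ i) 0 = 0" by (cases c) (simp_all add: h_def)
  then show False using free_cycD(3)[OF r _ assms, of 0] by simp
qed

text \<open>If a power t of a generator fixed the coset of x, the conjugate of t by x would be a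
  torsion element of \<open>S\<close>, hence trivial, although t is not.\<close>

lemma free_subgroup_moves_cosets:
  assumes S: "subgroup S H7" and free: "is_free_group (H7\<lparr>carrier := S\<rparr>)"
    and x: "x \<in> carrier H7" and i: "0 < i" "i < gen_order c"
  shows "S #>\<^bsub>H7\<^esub> (x \<otimes>\<^bsub>H7\<^esub> ev (replicate i c)) \<noteq> S #>\<^bsub>H7\<^esub> x"
proof
  let ?r = "gen_order c"
  let ?t = "ev (replicate i c)"
  let ?y = "x \<otimes>\<^bsub>H7\<^esub> ?t \<otimes>\<^bsub>H7\<^esub> inv\<^bsub>H7\<^esub> x"
  assume eq: "S #>\<^bsub>H7\<^esub> (x \<otimes>\<^bsub>H7\<^esub> ?t) = S #>\<^bsub>H7\<^esub> x"
  have t: "?t \<in> carrier H7" by (rule ev_in_carrier)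
  have "x \<otimes>\<^bsub>H7\<^esub> ?t \<in> S #>\<^bsub>H7\<^esub> x" using H.rcos_self[OF _ S, of "x \<otimes>\<^bsub>H7\<^esub> ?t"] x t eq by simp
  then obtain s where s: "s \<in> S" "x \<otimes>\<^bsub>H7\<^esub> ?t = s \<otimes>\<^bsub>H7\<^esub> x" by (auto simp: r_coset_def)
  have sG: "s \<in> carrier H7" using S s(1) by (rule subgroup.mem_carrier)
  have y: "?y = s" using s(2) sG x by (simp add: H.m_assoc)
  have "?t [^]\<^bsub>H7\<^esub> ?r = \<one>\<^bsub>H7\<^esub>"
  proof -
    have "?t [^]\<^bsub>H7\<^esub> ?r = ev (replicate (i * ?r) c)"
      by (simp only: ev_replicate_pow H.nat_pow_pow ev_in_carrier)
    also have "\<dots> = \<one>\<^bsub>H7\<^esub>" using ev_replicate_mod[of "i * ?r" c] by (simp add: ev_Nil)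
    finally show ?thesis .
  qed
  then have "?y [^]\<^bsub>H7\<^esub> ?r = \<one>\<^bsub>H7\<^esub>" using H.conjugate_pow[OF x t, of ?r] x by simp
  then have "s [^]\<^bsub>H7\<lparr>carrier := S\<rparr>\<^esub> ?r = \<one>\<^bsub>H7\<lparr>carrier := S\<rparr>\<^esub>"
    using y by (simp add: nat_pow_def)
  then have "s = \<one>\<^bsub>H7\<^esub>" using is_free_group_torsion_free[OF free, of s ?r] s(1) by simp
  then have "x \<otimes>\<^bsub>H7\<^esub> ?t = x" using s(2) x by simp
  then have "?t = \<one>\<^bsub>H7\<^esub>" using x t by simp
  then show False using ev_power_nontrivial[OF i] by simp
qed

text \<open>The generators act on the numbered right cosets by right multiplication, and
  \<open>S\<close> is the stabiliser of the coset \<open>S\<close>.\<close>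

lemma free_subgroup_is_stabiliser:
  assumes S: "S \<in> free_subgroups_of_index H7 N" and N: "N > 0"
  obtains f g where "hecke_action f g N" "S = hecke_action.stab f g"
proof -
  have sub: "subgroup S H7" and fr: "is_free_group (H7\<lparr>carrier := S\<rparr>)" and card: "card (rcosets\<^bsub>H7\<^esub> S) = N"
    using S by (auto simp: free_subgroups_of_index_def)
  have SG: "S \<subseteq> carrier H7" using sub by (rule subgroup.subset)
  let ?C = "rcosets\<^bsub>H7\<^esub> S"
  have "finite ?C" using card N card_ge_0_finite by auto
  then obtain r0 where r0: "bij_betw r0 ?C {..<N}" using card by (metis bij_betw_iff_card finite_lessThan card_lessThan)
  have "S \<in> ?C" using H.rcosetsI[OF SG H.one_closed] H.coset_mult_one[OF SG] by simp
  then have "r0 S \<in> {..<N}" using r0 by (auto simp: bij_betw_def)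
  \<comment> \<open>Renumbers the cosets so that \<open>S\<close> itself becomes the base point
    0.\<close>
  then have "Transposition.transpose (r0 S) 0 permutes {..<N}" using N by (intro permutes_swap_id) auto
  then have "bij_betw (Transposition.transpose (r0 S) 0 \<circ> r0) ?C {..<N}"
    using r0 by (metis bij_betw_trans permutes_imp_bij)
  then obtain r where r: "bij_betw r ?C {..<N}" "r S = 0" by force
  define q where "q = inv_into ?C r"
  have q: "bij_betw q {..<N} ?C" "q 0 = S"
    using bij_betw_inv_into[OF r(1)] bij_betw_inv_into_left[OF r(1) \<open>S \<in> ?C\<close>] r(2) by (simp_all add: q_def)
  have rq: "r (q y) = y" if "y \<in> {..<N}" for y using r(1) that by (simp add: q_def bij_betw_inv_into_right)
  have qr: "q (r P) = P" if "P \<in> ?C" for P using r(1) that by (simp add: q_def bij_betw_inv_into_left)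
  have move: "P #>\<^bsub>H7\<^esub> x \<in> ?C" if "P \<in> ?C" "x \<in> carrier H7" for P x
  proof -
    obtain z where z: "z \<in> carrier H7" "P = S #>\<^bsub>H7\<^esub> z" using \<open>P \<in> ?C\<close> unfolding RCOSETS_def by blast
    then show ?thesis using H.rcosetsI[OF SG, of "z \<otimes>\<^bsub>H7\<^esub> x"] that(2) SG by (simp add: H.coset_mult_assoc)
  qed
  \<comment> \<open>The identity outside \<open>{..<N}\<close> makes \<open>h c\<close> a
    permutation in the sense of \<open>permutes\<close>.\<close>
  define h where "h c y = (if y < N then r (q y #>\<^bsub>H7\<^esub> ev [c]) else y)" for c y
  have qC: "q y \<in> ?C" if "y < N" for y using q(1) that by (auto simp: bij_betw_def)
  have hN: "h c y < N" if "y < N" for c y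
    using move[OF qC[OF that] ev_in_carrier] r(1) that by (auto simp: h_def bij_betw_def)
  have qh: "q (h c y) = q y #>\<^bsub>H7\<^esub> ev [c]" if "y < N" for c y
    using move[OF qC[OF that] ev_in_carrier] that by (simp add: h_def qr)
  have qG: "q y \<subseteq> carrier H7" if "y < N" for y
    using qC[OF that] SG H.rcosets_subset_PowG[OF sub] by auto
  have q_inj: "y = z" if "q y = q z" "y < N" "z < N" for y z using that rq by (metis lessThan_iff)
  have qpow: "q ((h c ^^ i) y) = q y #>\<^bsub>H7\<^esub> ev (replicate i c) \<and> (h c ^^ i) y < N" if "y < N" for c i y
  proof (induction i)
    case 0
    then show ?case using that H.coset_mult_one[OF qG[OF that]] by (simp add: ev_Nil)
  next
    case (Suc i)
    have "ev (replicate (Suc i) c) = ev (replicate i c) \<otimes>\<^bsub>H7\<^esub> ev [c]"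
      by (simp add: replicate_append_same flip: ev_append)
    then show ?case using Suc qh hN H.coset_mult_assoc[OF qG[OF that] ev_in_carrier ev_in_carrier] by simp
  qed
  have free_h: "h c \<in> free_cyc (gen_order c) {..<N}" for c
  proof -
    let ?r = "gen_order c"
    have order: "(h c ^^ ?r) y = y" if "y < N" for y
    proof (rule q_inj)
      show "q ((h c ^^ ?r) y) = q y" using ev_gen_order[of c] qpow[OF that, of ?r c] H.coset_mult_one[OF qG[OF that]] by simp
    qed (use that qpow in auto)
    have "inj_on (h c) {..<N}"
    proof (rule inj_onI)
      fix y z assume yz: "y \<in> {..<N}" "z \<in> {..<N}" "h c y = h c z"
      have "(h c ^^ ?r) y = (h c ^^ (?r - 1)) (h c y)" "(h c ^^ ?r) z = (h c ^^ (?r - 1)) (h c z)"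
        by (simp_all flip: funpow_Suc_right[THEN fun_cong, unfolded comp_apply])
      then show "y = z" using yz order by simp
    qed
    moreover have "h c ` {..<N} \<subseteq> {..<N}" using hN by auto
    ultimately have "bij_betw (h c) {..<N} {..<N}"
      using endo_inj_surj[of "{..<N}" "h c"] by (simp add: bij_betw_def)
    then have "h c permutes {..<N}" by (rule bij_imp_permutes) (simp add: h_def)
    moreover have "(h c ^^ i) y \<noteq> y" if y: "y < N" and i: "0 < i" "i < ?r" for i y
    proof
      assume "(h c ^^ i) y = y"
      then have 1: "q y #>\<^bsub>H7\<^esub> ev (replicate i c) = q y" using qpow[OF y, of i c] by simp
      obtain x where x: "x \<in> carrier H7" "q y = S #>\<^bsub>H7\<^esub> x" using qC[OF y] by (auto simp: RCOSETS_def)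
      show False
        using free_subgroup_moves_cosets[OF sub fr x(1) i] 1 H.coset_mult_assoc[OF SG x(1) ev_in_carrier]
        by (simp add: x(2))
    qed
    ultimately show ?thesis using order by (auto simp: free_cyc_def)
  qed
  have act: "q (act (h True) (h False) w 0) = S #>\<^bsub>H7\<^esub> ev w \<and> act (h True) (h False) w 0 < N" for w
  proof (induction w rule: rev_induct)
    case Nil
    then show ?case using N q(2) H.coset_mult_one[OF SG] by (simp add: ev_Nil)
  next
    case (snoc c w)
    have "act (h True) (h False) (w @ [c]) 0 = h c (act (h True) (h False) w 0)" by simp
    then show ?case using snoc qh hN H.coset_mult_assoc[OF SG ev_in_carrier ev_in_carrier] by (simp add: ev_append)
  qed
  have "orb (h True) (h False) 0 = {..<N}"
  proof (intro equalityI subsetI)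
    fix y assume y: "y \<in> {..<N}"
    then obtain x where x: "x \<in> carrier H7" "q y = S #>\<^bsub>H7\<^esub> x" using qC[of y] by (auto simp: RCOSETS_def)
    obtain w where "x = ev w" using ev_surj[OF x(1)] .
    then have "y = act (h True) (h False) w 0" using act[of w] x(2) y by (intro q_inj) simp_all
    then show "y \<in> orb (h True) (h False) 0" by (simp add: orb_def)
  qed (use act in \<open>auto simp: orb_def\<close>)
  then have ha: "hecke_action (h True) (h False) N"
    using free_h[of True] free_h[of False] N
    by (simp add: hecke_action_def transitive_actions_def free_actions_def gen_order_def)
  interpret h: hecke_action "h True" "h False" N by (rule ha)
  have "ev w \<in> S \<longleftrightarrow> ev w \<in> h.stab" for w
  proof -
    have "ev w \<in> S \<longleftrightarrow> S #>\<^bsub>H7\<^esub> ev w = S"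
      using H.coset_join1[OF _ ev_in_carrier sub] H.coset_join2[OF ev_in_carrier sub] by blast
    also have "\<dots> \<longleftrightarrow> act (h True) (h False) w 0 = 0"
      using act[of w] q(2) q_inj[of _ 0] N by metis
    finally show ?thesis by (simp add: h.ev_in_stab_iff)
  qed
  then have "S = h.stab" using SG h.stab_subset ev_surj by (metis subset_antisym subset_iff)
  then show thesis using that ha by blast
qed

subsection \<open>Stabilisers are free\<close>

text \<open>Collects the points from which a word applies \<open>f\<close>. With g-orbits as
  vertices, only these steps traverse an edge; steps by \<open>g\<close> stay at a vertex.\<close>

fun crossings :: "('a \<Rightarrow> 'a) \<Rightarrow> ('a \<Rightarrow> 'a) \<Rightarrow> bool list \<Rightarrow> 'a \<Rightarrow> 'a set" where
  "crossings f g [] x = {}"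
| "crossings f g (b # w) x = (if b then insert x (crossings f g w (f x)) else crossings f g w (g x))"

lemma crossings_append:
  "crossings f g (u @ v) x = crossings f g u x \<union> crossings f g v (act f g u x)"
  by (induction u arbitrary: x) auto

lemma crossings_replicate_False: "crossings f g (replicate n False) x = {}"
  by (induction n arbitrary: x) auto

context hecke_action
begin

(* The edges y -- f y with y in T form a spanning tree of the part D of the graph whose vertices
   are the orbits of g; the word \<gamma> y describes the path from 0 to y inside the tree. *)
definition tree_paths :: "nat set \<Rightarrow> nat set \<Rightarrow> (nat \<Rightarrow> bool list) \<Rightarrow> bool" where
  "tree_paths D T \<gamma> \<longleftrightarrow> 0 \<in> D \<and> D \<subseteq> {..<N} \<and> T \<subseteq> D \<and> ev (\<gamma> 0) = ev [] \<and>
     (\<forall>y\<in>D. g y \<in> D \<and> act f g (\<gamma> y) 0 = y \<and> crossings f g (\<gamma> y) 0 \<subseteq> T \<and>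
        ev (\<gamma> (g y)) = ev (\<gamma> y @ [False])) \<and>
     (\<forall>y\<in>T. f y \<in> T \<and> ev (\<gamma> (f y)) = ev (\<gamma> y @ [True]))"

lemma ff: "y \<in> {..<N} \<Longrightarrow> f (f y) = y"
  using f_order[of y] by (simp add: numeral_2_eq_2)

lemma f_cyc: "f \<in> free_cyc 2 {..<N}" and g_cyc: "g \<in> free_cyc 7 {..<N}"
  using free by (auto simp: free_actions_def)

text \<open>An exponent locating a point in its g-orbit is determined only modulo 7, so independence
  of the choice holds for group elements, not for words. This is why \<open>tree_paths\<close>
  compares paths through \<open>ev\<close>.\<close>

lemma g_orbit_index:
  assumes z: "z \<in> {..<N}"
  shows "\<exists>\<iota>. \<forall>i. (g ^^ \<iota> ((g ^^ i) z)) z = (g ^^ i) z \<and>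
    ev (replicate (\<iota> ((g ^^ i) z)) False) = ev (replicate i False)"
proof -
  define \<iota> where "\<iota> u = (SOME j. (g ^^ j) z = u)" for u
  have 1: "(g ^^ \<iota> ((g ^^ i) z)) z = (g ^^ i) z" for i
    unfolding \<iota>_def by (rule someI) (rule refl)
  have 2: "ev (replicate (\<iota> ((g ^^ i) z)) False) = ev (replicate i False)" for i
  proof -
    let ?j = "\<iota> ((g ^^ i) z)"
    have "(g ^^ (?j mod 7)) z = (g ^^ (i mod 7)) z"
      using 1[of i] funpow_mod_eq[OF g_cyc z] by metis
    then have "?j mod 7 = i mod 7"
      using free_cyc_inj_on[OF g_cyc z] by (auto dest: inj_onD)
    then show ?thesis
      using ev_replicate_mod[of ?j False] ev_replicate_mod[of i False] by (simp add: gen_order_def)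
  qed
  show ?thesis using 1 2 by blast
qed

text \<open>The edge from \<open>y\<close> to \<open>f y\<close> leaves D, so it joins the tree
  together with the whole g-orbit of \<open>f y\<close>. Both endpoints enter T to keep it closed
  under \<open>f\<close>.\<close>

lemma tree_paths_extend:
  assumes tp: "tree_paths D T \<gamma>" and y: "y \<in> D" "f y \<notin> D"
  obtains D' T' \<gamma>' where "tree_paths D' T' \<gamma>'" "D \<subset> D'"
proof -
  define z where "z = f y"
  define Oz where "Oz = range (\<lambda>i. (g ^^ i) z)"
  note tp' = tp[unfolded tree_paths_def]
  have DN: "D \<subseteq> {..<N}" and TD: "T \<subseteq> D" using tp' by auto
  have D: "g u \<in> D" "act f g (\<gamma> u) 0 = u" "crossings f g (\<gamma> u) 0 \<subseteq> T"
    "ev (\<gamma> (g u)) = ev (\<gamma> u @ [False])" if "u \<in> D" for u using tp' that by auto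
  have T: "f u \<in> T" "ev (\<gamma> (f u)) = ev (\<gamma> u @ [True])" if "u \<in> T" for u using tp' that by auto
  have yN: "y \<in> {..<N}" using y DN by auto
  then have zN: "z \<in> {..<N}" and fz: "f z = y" using f_closed ff by (auto simp: z_def)
  have zD: "z \<notin> D" using y by (simp add: z_def)
  obtain \<iota> where \<iota>: "\<And>i. (g ^^ \<iota> ((g ^^ i) z)) z = (g ^^ i) z"
    "\<And>i. ev (replicate (\<iota> ((g ^^ i) z)) False) = ev (replicate i False)"
    using g_orbit_index[OF zN] by blast
  have OzN: "Oz \<subseteq> {..<N}" using free_cyc_funpow_in[OF g_cyc zN] by (auto simp: Oz_def)
  have OzD: "u \<notin> D" if u: "u \<in> Oz" for u
  proof
    obtain i where i: "u = (g ^^ i) z" using u by (auto simp: Oz_def)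
    assume "u \<in> D"
    then have "(g ^^ k) u \<in> D" for k using D(1) by (induction k) auto
    \<comment> \<open>As g has order 7, g^6 is its inverse: 6i further steps lead from u back to
      z.\<close>
    then have "(g ^^ (6 * i)) u \<in> D" .
    also have "(g ^^ (6 * i)) u = (g ^^ (6 * i + i)) z" by (simp only: i funpow_add comp_apply)
    also have "\<dots> = z" using funpow_mod_eq[OF g_cyc zN, of "6 * i + i"] by simp
    finally show False using zD by simp
  qed
  have zOz: "z \<in> Oz" unfolding Oz_def by (rule image_eqI[of _ _ 0]) auto
  have gOz: "g u \<in> Oz" if u: "u \<in> Oz" for u
  proof -
    obtain i where "u = (g ^^ i) z" using u by (auto simp: Oz_def)
    then have "g u = (g ^^ Suc i) z" by simp
    then show ?thesis unfolding Oz_def by (rule image_eqI) simp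
  qed
  define \<gamma>' where "\<gamma>' u = (if u \<in> D then \<gamma> u else \<gamma> y @ [True] @ replicate (\<iota> u) False)" for u
  define T' where "T' = T \<union> {y, z}"
  have old: "\<gamma>' u = \<gamma> u" if "u \<in> D" for u using that by (simp add: \<gamma>'_def)
  have new: "\<gamma>' u = \<gamma> y @ [True] @ replicate (\<iota> u) False" if "u \<in> Oz" for u
    using OzD[OF that] by (simp add: \<gamma>'_def)
  have ev_new: "ev (\<gamma>' ((g ^^ i) z)) = ev (\<gamma> y @ [True] @ replicate i False)" for i
  proof -
    have "(g ^^ i) z \<in> Oz" by (auto simp: Oz_def)
    then show ?thesis by (simp only: new ev_append \<iota>(2))
  qed
  have "tree_paths (D \<union> Oz) T' \<gamma>'"
    unfolding tree_paths_def
  proof (intro conjI ballI)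
    show "0 \<in> D \<union> Oz" "ev (\<gamma>' 0) = ev []" using tp' by (auto simp: old)
    show "D \<union> Oz \<subseteq> {..<N}" using DN OzN by auto
    show "T' \<subseteq> D \<union> Oz" using TD y(1) zOz by (auto simp: T'_def)
  next
    fix u assume "u \<in> D \<union> Oz"
    then consider "u \<in> D" | i where "u \<in> Oz" "u = (g ^^ i) z" by (auto simp: Oz_def)
    then have "g u \<in> D \<union> Oz \<and> act f g (\<gamma>' u) 0 = u \<and> crossings f g (\<gamma>' u) 0 \<subseteq> T' \<and>
      ev (\<gamma>' (g u)) = ev (\<gamma>' u @ [False])"
    proof cases
      case 1
      then show ?thesis using D[OF 1] D(1) by (auto simp: old T'_def)
    next
      case 2
      have "act f g (\<gamma>' u) 0 = u"
        using D(2)[OF y(1)] \<iota>(1)[of i] by (simp add: new[OF 2(1)]) (simp add: 2(2) flip: z_def)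
      moreover have "crossings f g (\<gamma>' u) 0 \<subseteq> T'"
        using D(2,3)[OF y(1)]
        by (auto simp: new[OF 2(1)] crossings_append crossings_replicate_False T'_def)
      moreover have "ev (\<gamma>' (g u)) = ev (\<gamma>' u @ [False])"
      proof -
        have "ev (\<gamma>' (g u)) = ev (\<gamma> y @ [True] @ replicate (Suc i) False)"
          using ev_new[of "Suc i"] by (simp only: 2(2) funpow.simps comp_apply)
        also have "replicate (Suc i) False = replicate i False @ [False]"
          by (simp add: replicate_append_same)
        finally show ?thesis
          unfolding 2(2) ev_append[of _ "[False]"] ev_new by (simp only: append_assoc flip: ev_append)
      qed
      ultimately show ?thesis using gOz[OF 2(1)] by simp
    qed
    then show "g u \<in> D \<union> Oz" "act f g (\<gamma>' u) 0 = u" "crossings f g (\<gamma>' u) 0 \<subseteq> T'"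
      "ev (\<gamma>' (g u)) = ev (\<gamma>' u @ [False])" by auto
  next
    fix u assume "u \<in> T'"
    then consider "u \<in> T" | "u = y" | "u = z" by (auto simp: T'_def)
    then have "f u \<in> T' \<and> ev (\<gamma>' (f u)) = ev (\<gamma>' u @ [True])"
    proof cases
      case 1
      then have "u \<in> D" "f u \<in> D" using T(1) TD by auto
      then show ?thesis using T[OF 1] by (simp add: old T'_def)
    next
      case 2
      then show ?thesis using ev_new[of 0] y(1) by (simp add: old T'_def z_def)
    next
      case 3
      \<comment> \<open>Crossing the new edge backwards from z to y appends a second
        \<open>True\<close>, which cancels the first.\<close>
      have "ev [True] \<otimes>\<^bsub>H7\<^esub> ev [True] = \<one>\<^bsub>H7\<^esub>"
        using ev_order(1) by (simp add: numeral_2_eq_2 flip: ev_append)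
      then show ?thesis using 3 ev_new[of 0] y(1)
        by (simp add: fz old T'_def ev_append[of _ "[True]"] H.m_assoc ev_in_carrier)
    qed
    then show "f u \<in> T'" "ev (\<gamma>' (f u)) = ev (\<gamma>' u @ [True])" by auto
  qed
  moreover have "D \<subset> D \<union> Oz" using zOz zD by auto
  ultimately show thesis by (rule that)
qed

lemma tree_paths_initial: obtains D T \<gamma> where "tree_paths D T \<gamma>"
proof -
  obtain \<iota> where \<iota>: "\<And>i. (g ^^ \<iota> ((g ^^ i) 0)) 0 = (g ^^ i) 0"
    "\<And>i. ev (replicate (\<iota> ((g ^^ i) 0)) False) = ev (replicate i False)"
    using g_orbit_index[OF zero_in] by blast
  have "tree_paths (range (\<lambda>i. (g ^^ i) 0)) {} (\<lambda>u. replicate (\<iota> u) False)"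
    unfolding tree_paths_def
  proof (intro conjI ballI)
    show "0 \<in> range (\<lambda>i. (g ^^ i) 0)" by (rule image_eqI[of _ _ 0]) auto
    show "range (\<lambda>i. (g ^^ i) 0) \<subseteq> {..<N}" using free_cyc_funpow_in[OF g_cyc zero_in] by auto
    show "ev (replicate (\<iota> 0) False) = ev []" using \<iota>(2)[of 0] by simp
  next
    fix u assume "u \<in> range (\<lambda>i. (g ^^ i) 0)"
    then obtain i where i: "u = (g ^^ i) 0" by auto
    have gu: "g u = (g ^^ Suc i) 0" by (simp add: i)
    show "g u \<in> range (\<lambda>i. (g ^^ i) 0)" unfolding gu by (rule rangeI)
    show "act f g (replicate (\<iota> u) False) 0 = u" using \<iota>(1)[of i] by (simp add: i)
    show "ev (replicate (\<iota> (g u)) False) = ev (replicate (\<iota> u) False @ [False])"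
      unfolding gu \<iota>(2) using \<iota>(2)[of i] by (simp add: i ev_append flip: replicate_append_same)
  qed (auto simp: crossings_replicate_False)
  then show thesis by (rule that)
qed

text \<open>Extension stops only when D is closed under both maps, and then transitivity makes it
  everything.\<close>

lemma spanning_tree: obtains T \<gamma> where "tree_paths {..<N} T \<gamma>"
proof -
  have "\<exists>T' \<gamma>'. tree_paths {..<N} T' \<gamma>'" if "tree_paths D T \<gamma>" for D T \<gamma>
    using that
  proof (induction "card ({..<N} - D)" arbitrary: D T \<gamma> rule: less_induct)
    case less
    have D: "D \<subseteq> {..<N}" "0 \<in> D" "\<And>y. y \<in> D \<Longrightarrow> g y \<in> D"
      using less.prems by (auto simp: tree_paths_def)
    show ?case
    proof (cases "\<exists>y\<in>D. f y \<notin> D")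
      case True
      then obtain D' T' \<gamma>' where ext: "tree_paths D' T' \<gamma>'" "D \<subset> D'"
        using tree_paths_extend[OF less.prems] by metis
      have "D' \<subseteq> {..<N}" using ext(1) by (simp add: tree_paths_def)
      then have "card ({..<N} - D') < card ({..<N} - D)" using ext(2) by (intro psubset_card_mono) auto
      then show ?thesis using less.hyps ext(1) by blast
    next
      case False
      then have "orb f g 0 \<subseteq> D" using D by (intro orb_subset) auto
      then have "D = {..<N}" using D(1) orbit by auto
      then show ?thesis using less.prems by blast
    qed
  qed
  then show thesis using tree_paths_initial that by metis
qed


text \<open>The loop at 0 that follows the tree to y, crosses one edge and returns through the tree.
  It is trivial for tree edges.\<close>

definition edge :: "(nat \<Rightarrow> bool list) \<Rightarrow> nat \<Rightarrow> (int + int) list set" where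
  "edge \<gamma> y = ev (\<gamma> y) \<otimes>\<^bsub>H7\<^esub> ev [True] \<otimes>\<^bsub>H7\<^esub> inv\<^bsub>H7\<^esub> ev (\<gamma> (f y))"

(* The stabiliser is the fundamental group of the graph: the edges outside a spanning tree are free
   generators. A homomorphism \<psi> from the free group is given by the generators; it is surjective
   because words telescope into products of edges, and injective because the labels of the edges
   crossed by a word define an action of H7 on pairs (point, element of the free group). *)
theorem is_free_group_stab: "is_free_group (H7\<lparr>carrier := stab\<rparr>)"
proof -
  obtain T \<gamma> where tp: "tree_paths {..<N} T \<gamma>" by (rule spanning_tree)
  note tp' = tp[unfolded tree_paths_def]
  have TN: "T \<subseteq> {..<N}" and ev_path0: "ev (\<gamma> 0) = ev []" using tp' by auto
  have path: "act f g (\<gamma> y) 0 = y" "crossings f g (\<gamma> y) 0 \<subseteq> T"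
    "ev (\<gamma> (g y)) = ev (\<gamma> y) \<otimes>\<^bsub>H7\<^esub> ev [False]" if "y \<in> {..<N}" for y
    using tp' that by (auto simp flip: ev_append)
  have T: "f y \<in> T" "ev (\<gamma> (f y)) = ev (\<gamma> y) \<otimes>\<^bsub>H7\<^esub> ev [True]" if "y \<in> T" for y
    using tp' that by (auto simp flip: ev_append)
  have fT: "f y \<in> T \<longleftrightarrow> y \<in> T" if "y \<in> {..<N}" for y using T(1)[of y] T(1)[of "f y"] ff[OF that] by auto
  have f_ne: "f y \<noteq> y" if "y \<in> {..<N}" for y using free_cycD(3)[OF f_cyc that, of 1] by simp
  have fN: "f y \<in> {..<N}" and gN: "g y \<in> {..<N}" if "y \<in> {..<N}" for y
    using f_closed g_closed that by auto
  have a_inv: "inv\<^bsub>H7\<^esub> ev [True] = ev [True]"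
    by (rule H.inv_equality) (use ev_order(1) in \<open>simp_all add: numeral_2_eq_2 ev_in_carrier flip: ev_append\<close>)
  have edge_word: "edge \<gamma> y = ev (\<gamma> y @ [True] @ winv 2 7 (\<gamma> (f y)))" for y
    unfolding edge_def ev_append ev_winv by (simp add: H.m_assoc ev_in_carrier)
  have winv_path: "act f g (winv 2 7 (\<gamma> y)) y = 0" if "y \<in> {..<N}" for y
    using act_winv_ev[OF zero_in, of "\<gamma> y"] path(1)[OF that] by simp
  have edge_stab: "edge \<gamma> y \<in> stab" if "y \<in> {..<N}" for y
    unfolding edge_word ev_in_stab_iff using path(1)[OF that] winv_path[OF fN[OF that]] by simp
  have edge_inv: "inv\<^bsub>H7\<^esub> edge \<gamma> (f y) = edge \<gamma> y" if "y \<in> {..<N}" for y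
    by (simp add: edge_def H.inv_mult_group ev_in_carrier a_inv ff[OF that] H.m_assoc)
  have edge_T: "edge \<gamma> y = \<one>\<^bsub>H7\<^esub>" if "y \<in> T" for y
    by (simp add: edge_def T(2)[OF that] ev_in_carrier)

  \<comment> \<open>One orientation of each edge outside the tree: \<open>f\<close> has no fixed
    point, so the smaller endpoint is a valid choice.\<close>
  define E where "E = {y \<in> {..<N} - T. y < f y}"
  \<comment> \<open>Points are renamed as group elements because \<open>is_free_group\<close> wants
    a basis in the element type of the group. These are only names, distinct since
    \<open>\<gamma> y\<close> leads to y; the generators of the stabiliser are the loops
    \<open>v x\<close>.\<close>
  define c where "c y = ev (\<gamma> y)" for y
  define X where "X = c ` E"
  define v where "v x = edge \<gamma> (inv_into E c x)" for x
  let ?F = "free_group X"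
  let ?K = "H7\<lparr>carrier := stab\<rparr>"
  interpret F: group ?F by (rule group_free_group)
  have K: "group ?K" by (rule subgroup.subgroup_is_group[OF subgroup_stab group_hecke])
  have EN: "E \<subseteq> {..<N}" by (auto simp: E_def)
  have c_inj: "inj_on c E"
  proof (rule inj_onI)
    fix y z assume yz: "y \<in> E" "z \<in> E" "c y = c z"
    then have "act f g (\<gamma> y) 0 = act f g (\<gamma> z) 0"
      unfolding c_def by (intro act_cong_ev[OF _ zero_in])
    moreover have "y \<in> {..<N}" "z \<in> {..<N}" using yz EN by auto
    ultimately show "y = z" by (simp only: path(1))
  qed
  have cX: "c y \<in> X" and vc: "v (c y) = edge \<gamma> y" if "y \<in> E" for y
    using that c_inj by (auto simp: X_def v_def)
  obtain \<psi> where \<psi>_hom: "\<psi> \<in> hom ?F ?K" and \<psi>: "\<And>x. x \<in> X \<Longrightarrow> \<psi> (free_class X [(x, True)]) = v x"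
    "\<And>x. x \<in> X \<Longrightarrow> \<psi> (free_class X [(x, False)]) = inv\<^bsub>?K\<^esub> v x"
  proof (rule free_group_hom_exists[OF K, of X v])
    show "v x \<in> carrier ?K" if "x \<in> X" for x
      using that vc edge_stab EN by (auto simp: X_def)
  qed blast
  have \<psi>_mult: "\<psi> (k \<otimes>\<^bsub>?F\<^esub> k') = \<psi> k \<otimes>\<^bsub>H7\<^esub> \<psi> k'" if "k \<in> carrier ?F" "k' \<in> carrier ?F" for k k'
    using hom_mult[OF \<psi>_hom that] by simp
  have \<psi>_in: "\<psi> k \<in> stab" if "k \<in> carrier ?F" for k using hom_in_carrier[OF \<psi>_hom that] by simp
  have \<psi>_one: "\<psi> \<one>\<^bsub>?F\<^esub> = \<one>\<^bsub>H7\<^esub>" using hom_one[OF \<psi>_hom group_free_group K] by simp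

  \<comment> \<open>Label of the edge crossed from y: trivial in the tree, a generator when leaving
    the smaller endpoint, its inverse in the opposite direction.\<close>
  define lab where "lab y = (if y \<in> T then \<one>\<^bsub>?F\<^esub> else if y < f y then free_class X [(c y, True)]
      else free_class X [(c (f y), False)])" for y
  have fE: "f y \<in> E" if "y \<in> {..<N}" "y \<notin> T" "\<not> y < f y" for y
    using that fN[OF that(1)] fT[OF that(1)] ff[OF that(1)] f_ne[OF that(1)] by (auto simp: E_def)
  have lab_in: "lab y \<in> carrier ?F" if y: "y \<in> {..<N}" for y
  proof -
    have gen_in: "free_class X [(x, e)] \<in> carrier ?F" if "x \<in> X" for x e
      using that by (auto simp: free_group_carrier)
    have "y \<notin> T \<Longrightarrow> y < f y \<Longrightarrow> c y \<in> X" using y by (intro cX) (simp add: E_def)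
    moreover have "y \<notin> T \<Longrightarrow> \<not> y < f y \<Longrightarrow> c (f y) \<in> X" using fE[OF y] cX by simp
    ultimately show ?thesis by (simp add: lab_def gen_in)
  qed
  have \<psi>_lab: "\<psi> (lab y) = edge \<gamma> y" if y: "y \<in> {..<N}" for y
  proof -
    consider "y \<in> T" | "y \<in> E" "y \<notin> T" "y < f y" | "f y \<in> E" "y \<notin> T" "\<not> y < f y"
      using fE[OF y] y by (auto simp: E_def)
    then show ?thesis
    proof cases
      case 1
      then show ?thesis by (simp add: lab_def edge_T \<psi>_one)
    next
      case 2
      then show ?thesis by (simp add: lab_def \<psi>(1) cX vc)
    next
      case 3
      have "\<psi> (lab y) = inv\<^bsub>?K\<^esub> edge \<gamma> (f y)" using 3 by (simp add: lab_def \<psi>(2) cX vc)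
      also have "\<dots> = inv\<^bsub>H7\<^esub> edge \<gamma> (f y)"
        by (rule H.m_inv_consistent[OF subgroup_stab edge_stab[OF fN[OF y]]])
      finally show ?thesis using edge_inv[OF y] by simp
    qed
  qed
  have lab_inv: "lab y \<otimes>\<^bsub>?F\<^esub> lab (f y) = \<one>\<^bsub>?F\<^esub>" if y: "y \<in> {..<N}" for y
  proof -
    have cancel: "free_class X [(x, e)] \<otimes>\<^bsub>?F\<^esub> free_class X [(x, \<not> e)] = \<one>\<^bsub>?F\<^esub>" if "x \<in> X" for x e
      using free_class_cancel[of "[]" "[]" X x e] that by (simp add: free_group_mult free_group_one)
    consider "y \<in> T" | "y \<in> E" "y \<notin> T" "y < f y" | "f y \<in> E" "y \<notin> T" "\<not> y < f y"
      using fE[OF y] y by (auto simp: E_def)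
    then show ?thesis
    proof cases
      case 1
      then show ?thesis using T(1) by (simp add: lab_def)
    next
      case 2
      then show ?thesis using fT[OF y] ff[OF y] cancel[OF cX, of y True] by (simp add: lab_def)
    next
      case 3
      then have "f y < y" using f_ne[OF y] by simp
      then show ?thesis using 3 fT[OF y] ff[OF y] cancel[OF cX, of "f y" False] by (simp add: lab_def)
    qed
  qed

  \<comment> \<open>Modulo the tree path to its endpoint, a word is a product of the loops it
    crosses. For a word fixing 0 that path is trivial, which gives surjectivity.\<close>
  have telescope: "\<exists>k\<in>carrier ?F. \<psi> k = ev w \<otimes>\<^bsub>H7\<^esub> inv\<^bsub>H7\<^esub> ev (\<gamma> (act f g w 0))" for w
  proof (induction w rule: rev_induct)
    case Nil
    show ?case by (rule bexI[of _ "\<one>\<^bsub>?F\<^esub>"]) (simp_all add: \<psi>_one ev_path0 ev_Nil)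
  next
    case (snoc d w)
    then obtain k where k: "k \<in> carrier ?F" "\<psi> k = ev w \<otimes>\<^bsub>H7\<^esub> inv\<^bsub>H7\<^esub> ev (\<gamma> (act f g w 0))" by blast
    define y where "y = act f g w 0"
    have y: "y \<in> {..<N}" using act_in[OF zero_in] by (simp add: y_def)
    show ?case
    proof (cases d)
      case True
      have "\<psi> (k \<otimes>\<^bsub>?F\<^esub> lab y) = ev w \<otimes>\<^bsub>H7\<^esub> ev [True] \<otimes>\<^bsub>H7\<^esub> inv\<^bsub>H7\<^esub> ev (\<gamma> (f y))"
        by (simp add: \<psi>_mult k lab_in[OF y] \<psi>_lab[OF y] edge_def H.m_assoc ev_in_carrier
            H.inv_mult_cancel flip: y_def)
      moreover have "k \<otimes>\<^bsub>?F\<^esub> lab y \<in> carrier ?F" using k(1) lab_in[OF y] by simp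
      ultimately show ?thesis using True by (intro bexI[of _ "k \<otimes>\<^bsub>?F\<^esub> lab y"]) (simp_all add: ev_append y_def)
    next
      case False
      have "\<psi> k = ev w \<otimes>\<^bsub>H7\<^esub> ev [False] \<otimes>\<^bsub>H7\<^esub> inv\<^bsub>H7\<^esub> ev (\<gamma> (g y))"
        by (simp add: k path(3)[OF y] H.inv_mult_group H.m_assoc ev_in_carrier H.inv_mult_cancel flip: y_def)
      then show ?thesis using False k(1) by (intro bexI[of _ k]) (simp_all add: ev_append y_def)
    qed
  qed

  \<comment> \<open>The covering action: a step by \<open>f\<close> also multiplies the free group
    component by the label of its edge. By \<open>lab_inv\<close> this lift is an involution, so
    C2*C7 acts on the covering.\<close>
  define F' where "F' = (\<lambda>(y, k). (f y, k \<otimes>\<^bsub>?F\<^esub> lab y))"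
  define G' where "G' = (\<lambda>(y :: nat, k :: ((int + int) list set \<times> bool) list set). (g y, k))"
  have F'_apply: "F' (y, k) = (f y, k \<otimes>\<^bsub>?F\<^esub> lab y)" for y k by (simp add: F'_def)
  let ?D = "{..<N} \<times> carrier ?F"
  have F'_in: "P \<in> ?D \<Longrightarrow> F' P \<in> ?D" and G'_in: "P \<in> ?D \<Longrightarrow> G' P \<in> ?D" for P
    using fN gN lab_in by (auto simp: F'_def G'_def)
  have F'_order: "(F' ^^ 2) P = P" if "P \<in> ?D" for P
    using that ff lab_in lab_inv fN by (auto simp: F'_def numeral_2_eq_2 F.m_assoc)
  have "(G' ^^ i) (y, k) = ((g ^^ i) y, k)" for i y k by (induction i) (simp_all add: G'_def)
  then have G'_order: "(G' ^^ 7) P = P" if "P \<in> ?D" for P using that g_order by auto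
  \<comment> \<open>Tree edges carry trivial labels, so walking in the tree never changes the second
    component.\<close>
  have walk: "act F' G' w (y, k) = (act f g w y, k)"
    if "y \<in> {..<N}" "k \<in> carrier ?F" "crossings f g w y \<subseteq> T" for w y k
    using that
  proof (induction w arbitrary: y)
    case (Cons d w)
    show ?case
    proof (cases d)
      case True
      then have "y \<in> T" "crossings f g w (f y) \<subseteq> T" using Cons.prems by auto
      then show ?thesis using True Cons.IH[of "f y"] Cons.prems fN by (simp add: F'_def lab_def)
    next
      case False
      then show ?thesis using Cons.IH[of "g y"] Cons.prems gN by (simp add: G'_def)
    qed
  qed simp
  have path_walk: "act F' G' (\<gamma> y) (0, k) = (y, k)" if "y \<in> {..<N}" "k \<in> carrier ?F" for y k
    using walk[OF zero_in that(2) path(2)[OF that(1)]] path(1)[OF that(1)] by simp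
  have path_walk_back: "act F' G' (winv 2 7 (\<gamma> y)) (y, k) = (0, k)" if "y \<in> {..<N}" "k \<in> carrier ?F" for y k
    using act_winv[OF F'_in G'_in _ F'_order G'_order, of "(0, k)" "\<gamma> y"] path_walk[OF that] that zero_in by simp
  \<comment> \<open>A word for the image of u under \<open>\<psi>\<close> multiplies the second
    component by u at the base point. The image therefore determines u, whence injectivity.\<close>
  have lift: "\<exists>w. \<psi> (free_class X u) = ev w \<and> (\<forall>k\<in>carrier ?F. act F' G' w (0, k) = (0, k \<otimes>\<^bsub>?F\<^esub> free_class X u))"
    if "u \<in> lists (X \<times> UNIV)" for u
    using that
  proof (induction u rule: rev_induct)
    case Nil
    have "free_class X [] = \<one>\<^bsub>?F\<^esub>" by (simp add: free_group_one)
    then show ?case by (intro exI[of _ "[]"]) (simp add: \<psi>_one ev_Nil)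
  next
    case (snoc l u)
    have u: "u \<in> lists (X \<times> UNIV)" and l: "[l] \<in> lists (X \<times> UNIV)" using snoc.prems by simp_all
    obtain w where w: "\<psi> (free_class X u) = ev w"
      "\<And>k. k \<in> carrier ?F \<Longrightarrow> act F' G' w (0, k) = (0, k \<otimes>\<^bsub>?F\<^esub> free_class X u)"
      using snoc.IH[OF u] by blast
    obtain y e where y: "y \<in> E" "l = (c y, e)" using l by (cases l) (auto simp: X_def)
    have yN: "y \<in> {..<N}" "y \<notin> T" "y < f y" using y(1) by (auto simp: E_def)
    \<comment> \<open>The endpoint from which the crossing has label l: a generator is read when
      leaving y, its inverse when leaving \<open>f y\<close>.\<close>
    define z where "z = (if e then y else f y)"
    have z: "z \<in> {..<N}" using yN fN by (simp add: z_def)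
    have lz: "lab z = free_class X [l]"
      using yN fT[OF yN(1)] ff[OF yN(1)] y(2) by (cases e) (simp_all add: lab_def z_def)
    have ul: "free_class X (u @ [l]) = free_class X u \<otimes>\<^bsub>?F\<^esub> lab z"
      unfolding lz by (rule free_group_mult[OF u l, symmetric])
    have uF: "free_class X u \<in> carrier ?F" unfolding free_group_carrier using u by (rule imageI)
    let ?w = "w @ \<gamma> z @ [True] @ winv 2 7 (\<gamma> (f z))"
    have "\<psi> (free_class X (u @ [l])) = ev w \<otimes>\<^bsub>H7\<^esub> edge \<gamma> z"
      unfolding ul using uF lab_in[OF z] by (simp add: \<psi>_mult w(1) \<psi>_lab[OF z])
    also have "\<dots> = ev ?w" unfolding edge_word by (rule ev_append[symmetric])
    finally have "\<psi> (free_class X (u @ [l])) = ev ?w" .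
    moreover have "act F' G' ?w (0, k) = (0, k \<otimes>\<^bsub>?F\<^esub> free_class X (u @ [l]))" if k: "k \<in> carrier ?F" for k
    proof -
      have "act F' G' ?w (0, k) = act F' G' (winv 2 7 (\<gamma> (f z))) (F' (z, k \<otimes>\<^bsub>?F\<^esub> free_class X u))"
        using k uF z by (simp add: w(2) path_walk)
      also have "\<dots> = (0, k \<otimes>\<^bsub>?F\<^esub> free_class X u \<otimes>\<^bsub>?F\<^esub> lab z)"
        using k uF z lab_in[OF z] fN[OF z] by (simp add: F'_apply path_walk_back)
      finally show ?thesis unfolding ul using k uF lab_in[OF z] by (simp add: F.m_assoc)
    qed
    ultimately show ?case by blast
  qed

  have "\<psi> \<in> iso ?F ?K"
  proof (rule isoI[OF \<psi>_hom bij_betw_imageI])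
    show "inj_on \<psi> (carrier ?F)"
    proof (rule inj_onI)
      fix k1 k2 assume k: "k1 \<in> carrier ?F" "k2 \<in> carrier ?F" "\<psi> k1 = \<psi> k2"
      obtain u1 where u1: "u1 \<in> lists (X \<times> UNIV)" "k1 = free_class X u1"
        using k(1) unfolding free_group_carrier by blast
      obtain u2 where u2: "u2 \<in> lists (X \<times> UNIV)" "k2 = free_class X u2"
        using k(2) unfolding free_group_carrier by blast
      obtain w1 where w1: "\<psi> k1 = ev w1" "act F' G' w1 (0, \<one>\<^bsub>?F\<^esub>) = (0, k1)"
        using lift[OF u1(1)] k(1) by (auto simp: u1(2))
      obtain w2 where w2: "\<psi> k2 = ev w2" "act F' G' w2 (0, \<one>\<^bsub>?F\<^esub>) = (0, k2)"
        using lift[OF u2(1)] k(2) by (auto simp: u2(2))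
      have "act F' G' w1 (0, \<one>\<^bsub>?F\<^esub>) = act F' G' w2 (0, \<one>\<^bsub>?F\<^esub>)"
        by (rule act_eq_of_ev_eq[OF F'_in G'_in F'_order G'_order])
          (use k(3) w1(1) w2(1) zero_in in auto)
      then show "k1 = k2" using w1(2) w2(2) by simp
    qed
    show "\<psi> ` carrier ?F = carrier ?K"
    proof (intro equalityI subsetI)
      fix x assume "x \<in> carrier ?K"
      then obtain w where w: "x = ev w" "act f g w 0 = 0" by (auto simp: stab_def)
      then obtain k where "k \<in> carrier ?F" "\<psi> k = x"
        using telescope[of w] by (auto simp: ev_path0 ev_Nil ev_in_carrier)
      then show "x \<in> \<psi> ` carrier ?F" by blast
    qed (use \<psi>_in in auto)
  qed
  then have "?F \<cong> ?K" by (auto simp: is_iso_def)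
  then have "?K \<cong> ?F" by (rule F.iso_sym)
  then show ?thesis unfolding is_free_group_def using K by blast
qed

end

section \<open>Free subgroups counted through stabilisers\<close>

lemma free_subgroups_of_index_eq:
  assumes "N > 0"
  shows "free_subgroups_of_index H7 N =
    (\<lambda>(f, g). hecke_action.stab f g) ` transitive_actions 2 7 {..<N} 0"
proof (intro equalityI subsetI)
  fix S assume "S \<in> free_subgroups_of_index H7 N"
  then obtain f g where "hecke_action f g N" "S = hecke_action.stab f g"
    using free_subgroup_is_stabiliser assms by blast
  then show "S \<in> (\<lambda>(f, g). hecke_action.stab f g) ` transitive_actions 2 7 {..<N} 0"
    by (auto simp: hecke_action_def)
next
  fix S assume "S \<in> (\<lambda>(f, g). hecke_action.stab f g) ` transitive_actions 2 7 {..<N} 0"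
  then obtain f g where fg: "(f, g) \<in> transitive_actions 2 7 {..<N} 0" "S = hecke_action.stab f g" by auto
  then interpret hecke_action f g N using assms by unfold_locales
  show "S \<in> free_subgroups_of_index H7 N"
    unfolding free_subgroups_of_index_def fg(2)
    using subgroup_stab is_free_group_stab card_rcosets_stab by simp
qed

text \<open>The stabiliser map is onto the free subgroups of index N. Two actions have equal
  stabiliser subgroups iff the same words fix 0, so every fibre has (N - 1)! elements.\<close>

lemma num_transitive_eq:
  assumes N: "N > 0"
  shows "num_transitive 2 7 N = fact (N - 1) * card (free_subgroups_of_index H7 N)"
proof -
  let ?T = "transitive_actions 2 7 {..<N} (0::nat)"
  define st where "st = (\<lambda>(f, g). hecke_action.stab f g :: (int + int) list set set)"
  have fibre: "card {fg \<in> ?T. st fg = S} = fact (N - 1)" if S: "S \<in> st ` ?T" for S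
  proof -
    obtain f0 g0 where fg0: "(f0, g0) \<in> ?T" "S = st (f0, g0)" using S by auto
    interpret a0: hecke_action f0 g0 N using fg0(1) N by unfold_locales
    have "st (f, g) = S \<longleftrightarrow> (\<forall>w. act f g w 0 = 0 \<longleftrightarrow> act f0 g0 w 0 = 0)" if "(f, g) \<in> ?T" for f g
    proof -
      interpret a: hecke_action f g N using that N by unfold_locales
      have "st (f, g) = S \<longleftrightarrow> (\<forall>w. ev w \<in> a.stab \<longleftrightarrow> ev w \<in> a0.stab)"
      proof
        assume R: "\<forall>w. ev w \<in> a.stab \<longleftrightarrow> ev w \<in> a0.stab"
        have "x \<in> a.stab \<longleftrightarrow> x \<in> a0.stab" for x
        proof (cases "x \<in> carrier H7")
          case True
          obtain w where "x = ev w" using ev_surj[OF True] .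
          then show ?thesis using R by simp
        qed (use a.stab_subset a0.stab_subset in blast)
        then show "st (f, g) = S" by (auto simp: fg0(2) st_def)
      qed (simp add: fg0(2) st_def)
      then show ?thesis by (simp add: a.ev_in_stab_iff a0.ev_in_stab_iff)
    qed
    then have "{fg \<in> ?T. st fg = S} = {(f, g) \<in> ?T. \<forall>w. act f g w 0 = 0 \<longleftrightarrow> act f0 g0 w 0 = 0}"
      by auto
    then show ?thesis
      using card_actions_same_stabiliser[OF fg0(1)] N by simp
  qed
  have fin: "finite ?T" by simp
  have "num_transitive 2 7 N = (\<Sum>S\<in>st ` ?T. card {fg \<in> ?T. st fg = S})"
    unfolding num_transitive_def using sum.image_gen[OF fin, of "\<lambda>_. 1 :: nat" st] by simp
  also have "\<dots> = fact (N - 1) * card (st ` ?T)" using fibre by simp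
  finally show ?thesis using free_subgroups_of_index_eq[OF N] by (simp add: st_def)
qed

subsection \<open>The subgroup series\<close>

definition num_free_subgroups :: "nat \<Rightarrow> nat" where
  "num_free_subgroups n = card (free_subgroups_of_index H7 n)"

definition action_density :: "nat \<Rightarrow> rat" where
  "action_density n = of_nat (num_free 2 n * num_free 7 n) / fact n"

lemma action_density_eq_0: "\<not> 14 dvd n \<Longrightarrow> action_density n = 0"
proof -
  assume "\<not> 14 dvd n"
  then have "\<not> 2 dvd n \<or> \<not> 7 dvd n" by presburger
  then show ?thesis using num_free_eq_0[of 2 n] num_free_eq_0[of 7 n] by (auto simp: action_density_def)
qed

text \<open>Division by n! absorbs the binomials and the factors (j - 1)!, leaving a convolution.
  This is the coefficient form of the relation between the density series and its logarithmic
  derivative.\<close>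

lemma action_density_recurrence:
  assumes "n > 0"
  shows "of_nat n * action_density n = (\<Sum>j\<in>{1..n}. of_nat (num_free_subgroups j) * action_density (n - j))"
proof -
  obtain m where m: "n = Suc m" using assms by (cases n) auto
  have summand: "of_nat ((m choose k) * (num_transitive 2 7 (Suc k) * (num_free 2 (m - k) * num_free 7 (m - k)))) =
      (fact m * (of_nat (num_free_subgroups (Suc k)) * action_density (m - k)) :: rat)" if "k \<le> m" for k
    using num_transitive_eq[of "Suc k"] that
    by (simp add: action_density_def num_free_subgroups_def binomial_fact field_simps)
  have "of_nat n * action_density n = of_nat (num_free 2 n * num_free 7 n) / fact m"
    by (simp only: action_density_def m fact_Suc) (simp del: of_nat_Suc of_nat_mult)
  also have "of_nat (num_free 2 n * num_free 7 n) =
      (\<Sum>k\<le>m. (fact m * (of_nat (num_free_subgroups (Suc k)) * action_density (m - k)) :: rat))"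
    unfolding m num_free_recurrence of_nat_sum by (intro sum.cong refl summand) simp
  also have "\<dots> / fact m = (\<Sum>k\<le>m. of_nat (num_free_subgroups (Suc k)) * action_density (m - k))"
    by (simp flip: sum_distrib_left)
  also have "\<dots> = (\<Sum>j\<in>{1..n}. of_nat (num_free_subgroups j) * action_density (n - j))"
    by (rule sum.reindex_bij_witness[where i = "\<lambda>j. j - 1" and j = Suc]) (auto simp: m)
  finally show ?thesis .
qed

text \<open>Unless 14 divides j, the term for j vanishes through its density factor at 14n -
  j.\<close>

lemma action_density_14_recurrence:
  "of_nat (14 * n) * action_density (14 * n) =
    (\<Sum>j\<in>{1..n}. of_nat (num_free_subgroups (14 * j)) * action_density (14 * (n - j)))"
proof (cases "n = 0")
  case False
  let ?a = "\<lambda>j. of_nat (num_free_subgroups j) * action_density (14 * n - j)"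
  have "of_nat (14 * n) * action_density (14 * n) = (\<Sum>j\<in>{1..14 * n}. ?a j)"
    using action_density_recurrence[of "14 * n"] False by simp
  also have "\<dots> = (\<Sum>j\<in>(\<lambda>j. 14 * j) ` {1..n}. ?a j)"
  proof (rule sum.mono_neutral_right)
    show "\<forall>j\<in>{1..14 * n} - (\<lambda>j. 14 * j) ` {1..n}. ?a j = 0"
    proof
      fix j assume j: "j \<in> {1..14 * n} - (\<lambda>j. 14 * j) ` {1..n}"
      have "\<not> 14 dvd j"
      proof
        assume "14 dvd j"
        then obtain i where "j = 14 * i" by auto
        then show False using j by auto
      qed
      then have "\<not> 14 dvd 14 * n - j" using j by (metis DiffD1 atLeastAtMost_iff dvd_diffD1 dvd_triv_left)
      then show "?a j = 0" by (simp add: action_density_eq_0)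
    qed
  qed auto
  also have "\<dots> = (\<Sum>j\<in>{1..n}. ?a (14 * j))" by (subst sum.reindex) (auto simp: inj_on_def)
  finally show ?thesis by (simp add: diff_mult_distrib2)
qed simp

text \<open>Each of the two closed counts has numerator (14n)!, and one of these cancels the (14n)!
  in the density.\<close>

lemma action_density_14_eq:
  "action_density (14 * n) * (2 ^ (7 * n) * fact (7 * n) * (7 ^ (2 * n) * fact (2 * n))) = fact (14 * n)"
proof -
  define a b :: rat where "a = 2 ^ (7 * n) * fact (7 * n)" and "b = 7 ^ (2 * n) * fact (2 * n)"
  define f :: rat where "f = fact (14 * n)"
  have 2: "of_nat (num_free 2 (14 * n)) * a = f"
    using arg_cong[OF num_free_mult[of 2 "7 * n"], of "of_nat :: nat \<Rightarrow> rat"] by (simp add: a_def f_def)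
  have 7: "of_nat (num_free 7 (14 * n)) * b = f"
    using arg_cong[OF num_free_mult[of 7 "2 * n"], of "of_nat :: nat \<Rightarrow> rat"] by (simp add: b_def f_def)
  have "action_density (14 * n) * (a * b) * f = (action_density (14 * n) * f) * (a * b)"
    by (simp add: mult_ac)
  also have "action_density (14 * n) * f = of_nat (num_free 2 (14 * n)) * of_nat (num_free 7 (14 * n))"
    by (simp add: action_density_def f_def)
  also have "\<dots> * (a * b) = (of_nat (num_free 2 (14 * n)) * a) * (of_nat (num_free 7 (14 * n)) * b)"
    by (simp add: mult_ac)
  also have "\<dots> = f * f" by (simp only: 2 7)
  finally have "action_density (14 * n) * (a * b) = f" by (simp add: f_def)
  then show ?thesis by (simp only: a_def b_def f_def)
qed

lemma fact_add_prod: "fact (m + k) = (fact m * (\<Prod>i<k. of_nat m + of_nat (Suc i)) :: rat)"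
  by (induction k) (simp_all add: algebra_simps)

text \<open>Among the new factors 14x+1, ..., 14x+14 the even ones give 2^7 \<open>Q\<close>, and
  14x+7 = 7(2x+1). Against the denominator 2^7 \<open>Q\<close> 49 (2x+1)(2x+2) this leaves
  \<open>P\<close> over 14(x+1).\<close>

lemma action_density_14_Suc:
  fixes n :: nat
  defines "x \<equiv> of_nat n :: rat"
  shows "14 * (x + 1) * action_density (14 * Suc n) = (14 * x + 1) * (14 * x + 3) * (14 * x + 5) *
    (14 * x + 9) * (14 * x + 11) * (14 * x + 13) * action_density (14 * n)"
proof -
  define Q where "Q = (7*x+1)*(7*x+2)*(7*x+3)*(7*x+4)*(7*x+5)*(7*x+6)*(7*x+7)"
  define P where "P = (14*x+1)*(14*x+3)*(14*x+5)*(14*x+9)*(14*x+11)*(14*x+13)"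
  define d where "d = (2 ^ (7 * n) * fact (7 * n) * (7 ^ (2 * n) * fact (2 * n)) :: rat)"
  have x: "x \<ge> 0" by (simp add: x_def)
  have f7: "fact (7 * Suc n) = (fact (7 * n) * Q :: rat)"
  proof -
    have "7 * Suc n = 7 * n + 7" by simp
    then show ?thesis
      by (simp only: fact_add_prod) (simp add: lessThan_nat_numeral Q_def x_def mult_ac)
  qed
  have f2: "fact (2 * Suc n) = (fact (2 * n) * ((2*x+1)*(2*x+2)) :: rat)"
  proof -
    have "2 * Suc n = 2 * n + 2" by simp
    then show ?thesis
      by (simp only: fact_add_prod) (simp add: lessThan_nat_numeral x_def mult_ac)
  qed
  have f14: "fact (14 * Suc n) = (fact (14 * n) * (128 * Q * (7 * (2*x+1)) * P) :: rat)"
  proof -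
    have "14 * Suc n = 14 * n + 14" by simp
    then have "fact (14 * Suc n) = fact (14 * n) * ((14*x+1)*(14*x+2)*(14*x+3)*(14*x+4)*(14*x+5)*(14*x+6)*
        (14*x+7)*(14*x+8)*(14*x+9)*(14*x+10)*(14*x+11)*(14*x+12)*(14*x+13)*(14*x+14))"
      by (simp only: fact_add_prod) (simp add: lessThan_nat_numeral x_def mult_ac)
    moreover have "14*x+2 = 2*(7*x+1)" "14*x+4 = 2*(7*x+2)" "14*x+6 = 2*(7*x+3)" "14*x+8 = 2*(7*x+4)"
      "14*x+10 = 2*(7*x+5)" "14*x+12 = 2*(7*x+6)" "14*x+14 = 2*(7*x+7)" "14*x+7 = 7*(2*x+1)"
      by simp_all
    moreover have "a1*(2*b1)*a3*(2*b2)*a5*(2*b3)*(7*s)*(2*b4)*a9*(2*b5)*a11*(2*b6)*a13*(2*b7) =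
        128*(b1*b2*b3*b4*b5*b6*b7)*(7*s)*(a1*a3*a5*a9*a11*a13)"
      for a1 a3 a5 a9 a11 a13 b1 b2 b3 b4 b5 b6 b7 s :: rat
      by (simp add: mult_ac)
    ultimately show ?thesis by (simp only: Q_def P_def)
  qed
  have "action_density (14 * Suc n) * (d * (128 * Q * (49 * ((2*x+1)*(2*x+2))))) = fact (14 * Suc n)"
  proof -
    have "2 ^ (7 * Suc n) = (128 * 2 ^ (7 * n) :: rat)" "7 ^ (2 * Suc n) = (49 * 7 ^ (2 * n) :: rat)"
      by (simp_all add: power_add)
    then have "action_density (14 * Suc n) * ((128 * 2 ^ (7 * n)) * (fact (7 * n) * Q) *
        ((49 * 7 ^ (2 * n)) * (fact (2 * n) * ((2*x+1)*(2*x+2))))) = fact (14 * Suc n)"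
      using action_density_14_eq[of "Suc n"] by (simp only: f7 f2)
    moreover have "h * ((128 * p) * (u * Q) * ((49 * r) * (v * t))) = h * (p * u * (r * v) * (128 * Q * (49 * t)))"
      for h p r t u v :: rat
      by (simp add: mult_ac)
    ultimately show ?thesis by (simp only: d_def)
  qed
  also have "\<dots> = action_density (14 * n) * d * (128 * Q * (7 * (2*x+1)) * P)"
    unfolding f14 d_def action_density_14_eq by (rule refl)
  finally have main: "action_density (14 * Suc n) * (d * (128 * Q * (49 * ((2*x+1)*(2*x+2))))) =
      action_density (14 * n) * d * (128 * Q * (7 * (2*x+1)) * P)" .
  have "(14 * (x + 1) * action_density (14 * Suc n)) * (d * 128 * Q * 7 * (2*x+1)) =
      (P * action_density (14 * n)) * (d * 128 * Q * 7 * (2*x+1))"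
  proof -
    have "14 * (x + 1) = 7 * (2*x+2)" by simp
    moreover have "7 * s * r * (d * 128 * Q * 7 * t) = r * (d * (128 * Q * (49 * (t * s))))" for r s t :: rat
      by (simp add: mult_ac)
    moreover have "h * d * (128 * Q * (7 * t) * P) = P * h * (d * 128 * Q * 7 * t)" for h t
      by (simp add: mult_ac)
    ultimately show ?thesis using main by (simp only:)
  qed
  moreover have "d * 128 * Q * 7 * (2*x+1) \<noteq> 0"
    using x by (simp add: d_def Q_def add_nonneg_eq_0_iff)
  ultimately have "14 * (x + 1) * action_density (14 * Suc n) = P * action_density (14 * n)"
    using mult_right_cancel by blast
  then show ?thesis by (simp only: P_def mult.assoc)
qed

subsection \<open>The differential equation\<close>

text \<open>The operator 14 z d/dz + c conjugated by a series with logarithmic derivative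
  \<open>S\<close>. The ring is left open: the identity is proved over \<open>rat\<close>, its
  parity is read off over \<open>int\<close>.\<close>

definition riccati_step :: "'a::comm_ring_1 fps \<Rightarrow> 'a \<Rightarrow> 'a fps \<Rightarrow> 'a fps" where
  "riccati_step S c w = fps_const 14 * (fps_X * fps_deriv w) + (fps_const c + S) * w"

text \<open>The coefficient 14 removes the derivative and the odd c becomes 1. Here
  \<open>w'\<close> is any series congruent to \<open>w\<close>, so that steps can be
  chained.\<close>

lemma riccati_step_mod2:
  fixes S :: "int fps"
  assumes "odd c" "2 dvd w - w'"
  shows "2 dvd riccati_step S c w - (1 + S) * w'"
proof -
  have "2 dvd fps_const (14 :: int)" "2 dvd fps_const (c - 1)"
    using assms(1) by (auto simp: two_dvd_fps_iff)
  then have "2 dvd fps_const 14 * (fps_X * fps_deriv w) + fps_const (c - 1) * w + (1 + S) * (w - w')"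
    using assms(2) by (intro dvd_add dvd_mult dvd_mult2) auto
  also have "\<dots> = riccati_step S c w - (1 + S) * w'"
    by (simp add: riccati_step_def algebra_simps flip: fps_const_sub)
  finally show ?thesis .
qed

text \<open>The density series has rational coefficients while the final equation involves only
  \<open>S\<close>; injectivity of this embedding brings that equation back to the integers.\<close>

definition fps_of_int_fps :: "int fps \<Rightarrow> 'a::comm_ring_1 fps" where
  "fps_of_int_fps F = Abs_fps (\<lambda>n. of_int (F $ n))"

lemma fps_of_int_fps_simps:
  "fps_of_int_fps (F + G) = fps_of_int_fps F + fps_of_int_fps G"
  "fps_of_int_fps (F * G) = fps_of_int_fps F * fps_of_int_fps G"
  "fps_of_int_fps (fps_deriv F) = fps_deriv (fps_of_int_fps F)"
  "fps_of_int_fps fps_X = fps_X" "fps_of_int_fps 1 = 1" "fps_of_int_fps (fps_const c) = fps_const (of_int c)"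
  by (auto simp: fps_of_int_fps_def fps_eq_iff fps_mult_nth fps_X_def)

lemma fps_of_int_fps_riccati_step:
  "fps_of_int_fps (riccati_step S c w) = riccati_step (fps_of_int_fps S) (of_int c) (fps_of_int_fps w)"
  by (simp add: riccati_step_def fps_of_int_fps_simps)

lemma fps_of_int_fps_inject: "fps_of_int_fps F = (fps_of_int_fps G :: rat fps) \<longleftrightarrow> F = G"
  by (auto simp: fps_of_int_fps_def fps_eq_iff)

text \<open>The constant term is forced to 0, as \<theta>D/D requires: index 0 in
  \<open>free_subgroups_of_index\<close> stands for infinite index.\<close>

definition subgroup_fps :: "int fps" where
  "subgroup_fps = Abs_fps (\<lambda>n. if n = 0 then 0 else int (num_free_subgroups (14 * n)))"

(* With \<theta> = 14 z d/dz, the recurrence of the densities reads \<theta>D = z (\<theta>+1)(\<theta>+3)...(\<theta>+13) D, and the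
   subgroup series is S = \<theta>D/D; conjugating by D turns \<theta> + c into \<theta> + c + S. *)
lemma subgroup_fps_eq:
  defines "R \<equiv> riccati_step subgroup_fps"
  shows "subgroup_fps = fps_X * R 1 (R 3 (R 5 (R 9 (R 11 (R 13 1)))))"
proof -
  define S :: "rat fps" where "S = fps_of_int_fps subgroup_fps"
  define D where "D = Abs_fps (\<lambda>n. action_density (14 * n))"
  define \<theta> :: "rat fps \<Rightarrow> rat fps" where "\<theta> w = fps_const 14 * (fps_X * fps_deriv w)" for w
  define L where "L c w = \<theta> w + fps_const c * w" for c w
  have \<theta>_nth: "\<theta> w $ n = 14 * of_nat n * w $ n" for w n by (cases n) (simp_all add: \<theta>_def)
  have L_nth: "L c w $ n = (14 * of_nat n + c) * w $ n" for c w n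
    by (simp add: L_def \<theta>_nth algebra_simps)
  have \<theta>D: "\<theta> D = S * D"
  proof (rule fps_ext)
    fix n
    have "(S * D) $ n = (\<Sum>j=0..n. S $ j * D $ (n - j))" by (rule fps_mult_nth)
    also have "\<dots> = (\<Sum>j\<in>{1..n}. S $ j * D $ (n - j))"
      by (rule sum.mono_neutral_right) (auto simp: S_def subgroup_fps_def fps_of_int_fps_def not_less_eq_eq)
    also have "\<dots> = (\<Sum>j\<in>{1..n}. of_nat (num_free_subgroups (14 * j)) * action_density (14 * (n - j)))"
      by (rule sum.cong) (auto simp: S_def D_def subgroup_fps_def fps_of_int_fps_def)
    also have "\<dots> = \<theta> D $ n"
      using action_density_14_recurrence[of n] by (simp add: \<theta>_nth D_def)
    finally show "\<theta> D $ n = (S * D) $ n" ..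
  qed
  have "S * D = fps_X * L 1 (L 3 (L 5 (L 9 (L 11 (L 13 D)))))"
  proof (rule fps_ext)
    fix n
    show "(S * D) $ n = (fps_X * L 1 (L 3 (L 5 (L 9 (L 11 (L 13 D)))))) $ n"
    proof (cases n)
      case (Suc m)
      then show ?thesis using action_density_14_Suc[of m]
        unfolding \<theta>D[symmetric] by (simp add: L_nth \<theta>_nth D_def mult.assoc add.commute)
    qed (simp add: \<theta>_nth flip: \<theta>D)
  qed
  \<comment> \<open>The product rule: its term w \<theta>D = w S D is what adds \<open>S\<close> to
    the operator.\<close>
  moreover have L_conj: "L c (w * D) = riccati_step S c w * D" for c w
  proof -
    have "\<theta> (w * D) = \<theta> w * D + w * \<theta> D" by (simp add: \<theta>_def algebra_simps)
    then show ?thesis unfolding \<theta>D by (simp add: L_def riccati_step_def \<theta>_def algebra_simps)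
  qed
  then have "L 13 D = riccati_step S 13 1 * D" using L_conj[of 13 1] by simp
  ultimately have "S * D = (fps_X * riccati_step S 1 (riccati_step S 3 (riccati_step S 5
      (riccati_step S 9 (riccati_step S 11 (riccati_step S 13 1)))))) * D"
    by (simp only: L_conj mult.assoc)
  \<comment> \<open>Its constant term is 1, and rational power series have no zero divisors, so D
    can be cancelled.\<close>
  moreover have "D \<noteq> 0"
    using action_density_14_eq[of 0] by (auto simp: D_def fps_eq_iff intro!: exI[of _ 0])
  ultimately have "S = fps_X * riccati_step S 1 (riccati_step S 3 (riccati_step S 5
      (riccati_step S 9 (riccati_step S 11 (riccati_step S 13 1)))))"
    by simp
  then have "fps_of_int_fps subgroup_fps = (fps_of_int_fps (fps_X * R 1 (R 3 (R 5 (R 9 (R 11 (R 13 1)))))) :: rat fps)"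
    by (simp add: R_def fps_of_int_fps_simps fps_of_int_fps_riccati_step flip: S_def)
  then show ?thesis by (simp only: fps_of_int_fps_inject)
qed

text \<open>Modulo 2 the differential equation becomes the functional equation for 1 + S, and adding
  1 changes no coefficient with n at least 1.\<close>

lemma odd_num_free_subgroups_iff:
  assumes "n \<ge> 1"
  shows "odd (num_free_subgroups (14 * n)) \<longleftrightarrow> built_from_blocks n"
proof -
  let ?S = subgroup_fps
  define R where "R = riccati_step ?S"
  have R: "2 dvd R c w - (1 + ?S) ^ Suc k" if "odd c" "2 dvd w - (1 + ?S) ^ k" for c w k
    using riccati_step_mod2[OF that, of ?S] by (simp add: R_def)
  \<comment> \<open>The innermost argument 1 is the power of exponent 0; each of the six operators
    then raises the exponent by one.\<close>
  have "2 dvd R 13 1 - (1 + ?S) ^ Suc 0" by (rule R) simp_all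
  then have "2 dvd R 1 (R 3 (R 5 (R 9 (R 11 (R 13 1))))) - (1 + ?S) ^ Suc (Suc (Suc (Suc (Suc (Suc 0)))))"
    by (intro R) simp_all
  then have "2 dvd R 1 (R 3 (R 5 (R 9 (R 11 (R 13 1))))) - (1 + ?S) ^ 6"
    by (simp add: numeral_eq_Suc)
  then have "2 dvd fps_X * (R 1 (R 3 (R 5 (R 9 (R 11 (R 13 1))))) - (1 + ?S) ^ 6)" by (rule dvd_mult)
  then have "2 dvd ?S - fps_X * (1 + ?S) ^ 6"
    using subgroup_fps_eq unfolding R_def by (metis right_diff_distrib)
  then have "2 dvd (1 + ?S) - (1 + fps_X * (1 + ?S) ^ 6)" by (simp add: algebra_simps)
  then have "odd ((1 + ?S) $ n) \<longleftrightarrow> built_from_blocks n" by (rule odd_nth_iff_built_from_blocks)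
  then show ?thesis using assms by (simp add: subgroup_fps_def)
qed

theorem theorem15:
  shows "(\<exists>!F :: int fps. fps_X * F ^ 6 - F + 1 = 0) \<and>
    (\<forall>F :: int fps. fps_X * F ^ 6 - F + 1 = 0 \<longrightarrow>
       (\<forall>n. odd (fps_nth F n) \<longleftrightarrow> built_from_blocks n)) \<and>
    (\<forall>n\<ge>1. odd (card (free_subgroups_of_index hecke_group_7 (14 * n))) \<longleftrightarrow> built_from_blocks n)"
proof (intro conjI allI impI)
  have eq: "fps_X * F ^ 6 - F + 1 = 0 \<longleftrightarrow> F = 1 + fps_X * F ^ 6" for F :: "int fps"
    by (auto simp: algebra_simps eq_diff_eq)
  show "\<exists>!F :: int fps. fps_X * F ^ 6 - F + 1 = 0"
    unfolding eq using fps_functional_equation_exists fps_functional_equation_unique by blast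
  show "odd (F $ n) \<longleftrightarrow> built_from_blocks n" if "fps_X * F ^ 6 - F + 1 = 0" for F :: "int fps" and n
  proof (rule odd_nth_iff_built_from_blocks)
    show "2 dvd F - (1 + fps_X * F ^ 6)" using that unfolding eq by simp
  qed
qed (use odd_num_free_subgroups_iff in \<open>simp add: num_free_subgroups_def\<close>)

end
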